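(* Let $\Omega\subseteq\mathbb{H}$ be a symmetric slice domain, let $f:\Omega\to\mathbb{H}$ be a regular function and let $q_0\in\Omega$. Choose $I,J\in\mathbb{S}$ so that $q_0\in L_I$ and $I\perp J$, let $z_1,z_2,\bar z_1,\bar z_2$ be the induced complex coordinates on $\mathbb{H}$, let $\partial_1,\partial_2,\bar\partial_1,\bar\partial_2$ be the corresponding derivations, and split $f=f_1+f_2J$ with $f_1,f_2:\Omega\to L_I$. Then $$\left.\begin{pmatrix}\bar\partial_1f_1&\bar\partial_2f_1\\ \bar\partial_1f_2&\bar\partial_2f_2\end{pmatrix}\right|_{q_0}=\begin{pmatrix}0&0\\0&0\end{pmatrix}.$$ Furthermore, if $R_{q_0}f$ splits as $R_{q_0}f=R_1+R_2J$ with $R_1,R_2:\Omega\to L_I$, then $$\left.\begin{pmatrix}\partial_1f_1&\partial_2f_1\\ \partial_1f_2&\partial_2f_2\end{pmatrix}\right|_{q_0}=\begin{pmatrix}R_1(q_0)&-\overline{R_2(\bar q_0)}\\ R_2(q_0)&\overline{R_1(\bar q_0)}\end{pmatrix}.$$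
   Context: $\mathbb{H}$ is the real algebra of quaternions with conjugation $q\mapsto\bar q$; $\mathbb{S}=\{q\in\mathbb{H}:q^2=-1\}$; for $I\in\mathbb{S}$, $L_I=\mathbb{R}+I\mathbb{R}\simeq\mathbb{C}$. For a domain (connected open set) $\Omega\subseteq\mathbb{H}$ and $f:\Omega\to\mathbb{H}$, put $\Omega_I=\Omega\cap L_I$, $f_I=f|_{\Omega_I}$. The function $f$ is (slice) regular if for every $I\in\mathbb{S}$ the restriction $f_I$ is holomorphic, i.e. $\frac12\left(\frac{\partial}{\partial x}+I\frac{\partial}{\partial y}\right)f_I(x+Iy)=0$ identically on $\Omega_I$. A domain $\Omega$ is a slice domain if it intersects the real axis and $\Omega_I$ is a domain in $L_I$ for all $I\in\mathbb{S}$; it is symmetric if $x+Iy\in\Omega$ (with $x,y\in\mathbb{R}$, $I\in\mathbb{S}$) implies $x+y\mathbb{S}=\{x+yJ:J\in\mathbb{S}\}\subseteq\Omega$. Complex coordinates induced by $I\perp J$: let $x_0,x_1,x_2,x_3$ be the real coordinates on $\mathbb{H}$ with respect to the basis $e_0=1,e_1=I,e_2=J,e_3=IJ$. Identify $\mathbb{H}=L_I+L_IJ$ with $\mathbb{C}^2$ by $z_1=x_0+Ix_1$, $z_2=x_2+Ix_3$, $\bar z_1=x_0-Ix_1$, $\bar z_2=x_2-Ix_3$, and set $$\partial_1=\tfrac12\left(\tfrac{\partial}{\partial x_0}-I\tfrac{\partial}{\partial x_1}\right),\ \bar\partial_1=\tfrac12\left(\tfrac{\partial}{\partial x_0}+I\tfrac{\partial}{\partial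 x_1}\right),\ \partial_2=\tfrac12\left(\tfrac{\partial}{\partial x_2}-I\tfrac{\partial}{\partial x_3}\right),\ \bar\partial_2=\tfrac12\left(\tfrac{\partial}{\partial x_2}+I\tfrac{\partial}{\partial x_3}\right).$$ Regular product: if $f,g$ are regular on a symmetric slice domain $\Omega$, choose $I,J\in\mathbb{S}$ with $I\perp J$ and write $f_I=F+GJ$, $g_I=H+KJ$ with $F,G,H,K:\Omega_I\to L_I$ holomorphic; $f*g$ is the unique regular function on $\Omega$ whose restriction to $\Omega_I$ is $[F(z)H(z)-G(z)\overline{K(\bar z)}]+[F(z)K(z)+G(z)\overline{H(\bar z)}]J$ (independent of the choice of $I,J$). It extends the product $\left(\sum q^na_n\right)*\left(\sum q^nb_n\right)=\sum q^n\sum_{k=0}^na_kb_{n-k}$ of power series. Operator $R_{q_0}$: for $f$ regular on a symmetric slice domain $\Omega$ and $q_0\in\Omega$, $R_{q_0}f:\Omega\to\mathbb{H}$ denotes the (unique, known to exist) regular function such that $f(q)=f(q_0)+(q-q_0)*R_{q_0}f(q)$ on $\Omega$. (If $q_0\in L_I$, then $f(z)=f(q_0)+(z-q_0)R_{q_0}f(z)$ for $z\in\Omega_I$.) *)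

theory Defs
  imports "HOL-Analysis.Analysis"
begin

section \<open>The real algebra of quaternions\<close>

datatype quat = Quat (qre: real) (qim1: real) (qim2: real) (qim3: real)

lemma quat_eq_iff:
  "p = q \<longleftrightarrow> qre p = qre q \<and> qim1 p = qim1 q \<and> qim2 p = qim2 q \<and> qim3 p = qim3 q"
  by (cases p; cases q) simp

instantiation quat :: real_vector
begin

definition zero_quat where "0 = Quat 0 0 0 0"

definition plus_quat where
  "p + q = Quat (qre p + qre q) (qim1 p + qim1 q) (qim2 p + qim2 q) (qim3 p + qim3 q)"

definition minus_quat where
  "p - q = Quat (qre p - qre q) (qim1 p - qim1 q) (qim2 p - qim2 q) (qim3 p - qim3 q)"

definition uminus_quat where
  "- q = Quat (- qre q) (- qim1 q) (- qim2 q) (- qim3 q)"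

definition scaleR_quat where
  "r *\<^sub>R q = Quat (r * qre q) (r * qim1 q) (r * qim2 q) (r * qim3 q)"

instance
  by standard
    (simp_all add: quat_eq_iff zero_quat_def plus_quat_def minus_quat_def uminus_quat_def
      scaleR_quat_def algebra_simps)

end

lemma quat_sel_vector_space [simp]:
  "qre 0 = 0" "qim1 0 = 0" "qim2 0 = 0" "qim3 0 = 0"
  "qre (p + q) = qre p + qre q" "qim1 (p + q) = qim1 p + qim1 q"
  "qim2 (p + q) = qim2 p + qim2 q" "qim3 (p + q) = qim3 p + qim3 q"
  "qre (p - q) = qre p - qre q" "qim1 (p - q) = qim1 p - qim1 q"
  "qim2 (p - q) = qim2 p - qim2 q" "qim3 (p - q) = qim3 p - qim3 q"
  "qre (- q) = - qre q" "qim1 (- q) = - qim1 q" "qim2 (- q) = - qim2 q" "qim3 (- q) = - qim3 q"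
  "qre (r *\<^sub>R q) = r * qre q" "qim1 (r *\<^sub>R q) = r * qim1 q"
  "qim2 (r *\<^sub>R q) = r * qim2 q" "qim3 (r *\<^sub>R q) = r * qim3 q"
  by (simp_all add: zero_quat_def plus_quat_def minus_quat_def uminus_quat_def scaleR_quat_def)

instantiation quat :: real_algebra_1
begin

definition one_quat where "1 = Quat 1 0 0 0"

definition times_quat where
  "p * q = Quat
    (qre p * qre q - qim1 p * qim1 q - qim2 p * qim2 q - qim3 p * qim3 q)
    (qre p * qim1 q + qim1 p * qre q + qim2 p * qim3 q - qim3 p * qim2 q)
    (qre p * qim2 q - qim1 p * qim3 q + qim2 p * qre q + qim3 p * qim1 q)
    (qre p * qim3 q + qim1 p * qim2 q - qim2 p * qim1 q + qim3 p * qre q)"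

instance
  by standard (simp_all add: quat_eq_iff one_quat_def times_quat_def algebra_simps)

end

lemma quat_sel_algebra [simp]:
  "qre 1 = 1" "qim1 1 = 0" "qim2 1 = 0" "qim3 1 = 0"
  "qre (p * q) = qre p * qre q - qim1 p * qim1 q - qim2 p * qim2 q - qim3 p * qim3 q"
  "qim1 (p * q) = qre p * qim1 q + qim1 p * qre q + qim2 p * qim3 q - qim3 p * qim2 q"
  "qim2 (p * q) = qre p * qim2 q - qim1 p * qim3 q + qim2 p * qre q + qim3 p * qim1 q"
  "qim3 (p * q) = qre p * qim3 q + qim1 p * qim2 q - qim2 p * qim1 q + qim3 p * qre q"
  "qre (of_real r) = r" "qim1 (of_real r) = 0" "qim2 (of_real r) = 0" "qim3 (of_real r) = 0"
  by (simp_all add: one_quat_def times_quat_def of_real_def)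

definition qcnj :: "quat \<Rightarrow> quat" where
  "qcnj q = Quat (qre q) (- qim1 q) (- qim2 q) (- qim3 q)"

lemma quat_sel_qcnj [simp]:
  "qre (qcnj q) = qre q" "qim1 (qcnj q) = - qim1 q"
  "qim2 (qcnj q) = - qim2 q" "qim3 (qcnj q) = - qim3 q"
  by (simp_all add: qcnj_def)

instantiation quat :: real_inner
begin

definition inner_quat where
  "p \<bullet> q = qre p * qre q + qim1 p * qim1 q + qim2 p * qim2 q + qim3 p * qim3 q"

definition norm_quat where "norm (q::quat) = sqrt (q \<bullet> q)"

definition sgn_quat where "sgn (q::quat) = q /\<^sub>R norm q"

definition dist_quat where "dist (p::quat) q = norm (p - q)"

definition uniformity_quat where
  "(uniformity :: (quat \<times> quat) filter) =
    (INF e\<in>{0 <..}. principal {(p, q). dist p q < e})"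

definition open_quat where
  "open (U :: quat set) \<longleftrightarrow> (\<forall>p\<in>U. \<forall>\<^sub>F (p', q) in uniformity. p' = p \<longrightarrow> q \<in> U)"

instance
proof
  fix p q r :: quat and c :: real
  show "0 \<le> p \<bullet> p"
    by (simp add: inner_quat_def)
  show "p \<bullet> p = 0 \<longleftrightarrow> p = 0"
    by (simp add: inner_quat_def quat_eq_iff add_nonneg_eq_0_iff)
qed (auto simp: inner_quat_def norm_quat_def sgn_quat_def dist_quat_def uniformity_quat_def
    open_quat_def algebra_simps)

end

lemma norm_quat_mult: "norm (p * q) = norm p * norm (q::quat)"
proof -
  have "(p * q) \<bullet> (p * q) = (p \<bullet> p) * (q \<bullet> q)"
    unfolding inner_quat_def quat_sel_algebra by algebra
  then show ?thesis
    by (simp only: norm_quat_def real_sqrt_mult)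
qed

instantiation quat :: real_normed_div_algebra
begin

definition inverse_quat where "inverse (q::quat) = qcnj q /\<^sub>R (q \<bullet> q)"

definition divide_quat where "(p::quat) div q = p * inverse q"

instance
proof
  fix p q :: quat
  show "inverse (0::quat) = 0"
    by (simp add: inverse_quat_def)
  show "p div q = p * inverse q"
    by (simp add: divide_quat_def)
  show "norm (p * q) = norm p * norm q"
    by (rule norm_quat_mult)
  assume "q \<noteq> 0"
  then have nz: "q \<bullet> q \<noteq> 0"
    by simp
  have "q * qcnj q = (q \<bullet> q) *\<^sub>R 1" "qcnj q * q = (q \<bullet> q) *\<^sub>R 1"
    by (simp_all add: quat_eq_iff inner_quat_def)
  with nz show "inverse q * q = 1" "q * inverse q = 1"
    by (simp_all add: inverse_quat_def)
qed

end

instantiation quat :: euclidean_space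
begin

definition Basis_quat where
  "Basis = {Quat 1 0 0 0, Quat 0 1 0 0, Quat 0 0 1 0, Quat 0 0 0 1}"

instance
proof
  fix p q :: quat
  show "p \<bullet> q = (if p = q then 1 else 0)" if "p \<in> Basis" "q \<in> Basis"
    using that unfolding Basis_quat_def by (elim insertE emptyE) (simp_all add: inner_quat_def)
  show "(\<forall>q\<in>Basis. p \<bullet> q = 0) \<longleftrightarrow> p = 0"
    by (simp add: Basis_quat_def inner_quat_def quat_eq_iff [of p])
qed (simp_all add: Basis_quat_def)

end


section \<open>Slices and slice domains\<close>

definition imag_units :: "quat set" where
  "imag_units = {q. q\<^sup>2 = - 1}"

definition slice_pt :: "quat \<Rightarrow> real \<Rightarrow> real \<Rightarrow> quat" where
  "slice_pt I x y = of_real x + I * of_real y"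

definition slice :: "quat \<Rightarrow> quat set" where
  "slice I = {slice_pt I x y | x y. True}"

definition slice_domain :: "quat set \<Rightarrow> bool" where
  "slice_domain \<Omega> \<longleftrightarrow> open \<Omega> \<and> connected \<Omega> \<and> \<Omega> \<inter> \<real> \<noteq> {} \<and>
    (\<forall>I\<in>imag_units. openin (top_of_set (slice I)) (\<Omega> \<inter> slice I) \<and> connected (\<Omega> \<inter> slice I))"

definition symmetric_set :: "quat set \<Rightarrow> bool" where
  "symmetric_set \<Omega> \<longleftrightarrow>
    (\<forall>x y. \<forall>I\<in>imag_units. slice_pt I x y \<in> \<Omega> \<longrightarrow> {slice_pt K x y | K. K \<in> imag_units} \<subseteq> \<Omega>)"

definition orthogonal_units :: "quat \<Rightarrow> quat \<Rightarrow> bool" where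
  "orthogonal_units I J \<longleftrightarrow> I \<in> imag_units \<and> J \<in> imag_units \<and> I \<bullet> J = 0"


section \<open>Regular functions\<close>

text \<open>
  Functions on a set \<open>\<Omega>\<close> of quaternions are total functions of which only the values on \<open>\<Omega>\<close> matter.

  Holomorphy on a relatively open subset \<open>A\<close> of the slice of \<open>I\<close> means real differentiability
  in \<open>(x, y)\<close> together with the Cauchy-Riemann equation (mere existence of the two partial
  derivatives would not be enough). Here \<open>D (1, 0)\<close> and \<open>D (0, 1)\<close> are the partial derivatives with
  respect to \<open>x\<close> and \<open>y\<close>.
\<close>

definition slice_holomorphic_on :: "quat \<Rightarrow> quat set \<Rightarrow> (quat \<Rightarrow> quat) \<Rightarrow> bool" where
  "slice_holomorphic_on I A f \<longleftrightarrow>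
    (\<forall>x y. slice_pt I x y \<in> A \<longrightarrow>
      (\<exists>D. ((\<lambda>(x, y). f (slice_pt I x y)) has_derivative D) (at (x, y)) \<and>
           (1/2) *\<^sub>R (D (1, 0) + I * D (0, 1)) = 0))"

definition regular_on :: "quat set \<Rightarrow> (quat \<Rightarrow> quat) \<Rightarrow> bool" where
  "regular_on \<Omega> f \<longleftrightarrow> (\<forall>I\<in>imag_units. slice_holomorphic_on I (\<Omega> \<inter> slice I) f)"

definition splits_on ::
  "quat set \<Rightarrow> quat \<Rightarrow> quat \<Rightarrow> (quat \<Rightarrow> quat) \<Rightarrow> (quat \<Rightarrow> quat) \<Rightarrow> (quat \<Rightarrow> quat) \<Rightarrow> bool" where
  "splits_on A I J f F G \<longleftrightarrow>
    (\<forall>q\<in>A. F q \<in> slice I \<and> G q \<in> slice I \<and> f q = F q + G q * J)"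

definition is_regular_product ::
  "quat set \<Rightarrow> (quat \<Rightarrow> quat) \<Rightarrow> (quat \<Rightarrow> quat) \<Rightarrow> (quat \<Rightarrow> quat) \<Rightarrow> bool" where
  "is_regular_product \<Omega> f g h \<longleftrightarrow> regular_on \<Omega> h \<and>
    (\<exists>I J F G H K. orthogonal_units I J \<and>
      splits_on (\<Omega> \<inter> slice I) I J f F G \<and> splits_on (\<Omega> \<inter> slice I) I J g H K \<and>
      slice_holomorphic_on I (\<Omega> \<inter> slice I) F \<and> slice_holomorphic_on I (\<Omega> \<inter> slice I) G \<and>
      slice_holomorphic_on I (\<Omega> \<inter> slice I) H \<and> slice_holomorphic_on I (\<Omega> \<inter> slice I) K \<and>
      (\<forall>z\<in>\<Omega> \<inter> slice I.
        h z = (F z * H z - G z * qcnj (K (qcnj z))) + (F z * K z + G z * qcnj (H (qcnj z))) * J))"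

text \<open>
  On a symmetric slice domain \<open>\<Omega>\<close> and for regular arguments, the following two functions
  exist and their values on \<open>\<Omega>\<close> are uniquely determined; \<open>SOME\<close> rather than \<open>THE\<close> is used
  because the values off \<open>\<Omega>\<close> are irrelevant.
\<close>

definition regular_product ::
  "quat set \<Rightarrow> (quat \<Rightarrow> quat) \<Rightarrow> (quat \<Rightarrow> quat) \<Rightarrow> (quat \<Rightarrow> quat)" where
  "regular_product \<Omega> f g = (SOME h. is_regular_product \<Omega> f g h)"

definition R_op :: "quat set \<Rightarrow> quat \<Rightarrow> (quat \<Rightarrow> quat) \<Rightarrow> (quat \<Rightarrow> quat)" where
  "R_op \<Omega> q0 f = (SOME r. regular_on \<Omega> r \<and>
    (\<forall>q\<in>\<Omega>. f q = f q0 + regular_product \<Omega> (\<lambda>q. q - q0) r q))"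


section \<open>Complex derivations induced by orthogonal units\<close>

text \<open>
  The real coordinates are those of the basis \<open>1\<close>, \<open>I\<close>, \<open>J\<close>, \<open>I * J\<close>, so that the partial derivative
  with respect to a coordinate is the directional derivative along the corresponding basis vector.
\<close>

definition has_partials :: "quat \<Rightarrow> quat \<Rightarrow> (quat \<Rightarrow> quat) \<Rightarrow> quat \<Rightarrow> bool" where
  "has_partials I J g q \<longleftrightarrow>
    (\<forall>e\<in>{1, I, J, I * J}. (\<lambda>t::real. g (q + t *\<^sub>R e)) differentiable (at 0))"

definition partial :: "quat \<Rightarrow> (quat \<Rightarrow> quat) \<Rightarrow> quat \<Rightarrow> quat" where
  "partial e g q = vector_derivative (\<lambda>t. g (q + t *\<^sub>R e)) (at 0)"

definition d1 :: "quat \<Rightarrow> (quat \<Rightarrow> quat) \<Rightarrow> quat \<Rightarrow> quat" where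
  "d1 I g q = (1/2) *\<^sub>R (partial 1 g q - I * partial I g q)"

definition dbar1 :: "quat \<Rightarrow> (quat \<Rightarrow> quat) \<Rightarrow> quat \<Rightarrow> quat" where
  "dbar1 I g q = (1/2) *\<^sub>R (partial 1 g q + I * partial I g q)"

definition d2 :: "quat \<Rightarrow> quat \<Rightarrow> (quat \<Rightarrow> quat) \<Rightarrow> quat \<Rightarrow> quat" where
  "d2 I J g q = (1/2) *\<^sub>R (partial J g q - I * partial (I * J) g q)"

definition dbar2 :: "quat \<Rightarrow> quat \<Rightarrow> (quat \<Rightarrow> quat) \<Rightarrow> quat \<Rightarrow> quat" where
  "dbar2 I J g q = (1/2) *\<^sub>R (partial J g q + I * partial (I * J) g q)"

abbreviation matrix2 :: "quat \<Rightarrow> quat \<Rightarrow> quat \<Rightarrow> quat \<Rightarrow> quat^2^2" where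
  "matrix2 a b c d \<equiv> vector [vector [a, b], vector [c, d]]"

end

theory Submission
  imports Defs "HOL-Complex_Analysis.Conformal_Mappings"
begin

text \<open>
  The proof reduces the two Jacobian matrices to one formula for the real differential of \<open>f\<close> at
  \<open>q0\<close>. Write \<open>r\<close> for \<open>R_op \<Omega> q0 f\<close>. Away from the real axis, with \<open>Im q\<close> the vector part of \<open>q\<close>,
  the defining equation \<open>f = f q0 + (q - q0) * r\<close> (regular product) reads pointwise

    \<open>f q = f q0 + (q - q0) r(q) + (q0 (q - q0) - (q - q0) q0) (2 Im q)\<^sup>-\<^sup>1 (r(q) - r(cnj q))\<close>,

  where the last term measures the failure of \<open>q0\<close> to commute with \<open>q\<close> (\<open>R_op_expansion\<close>). Both
  correction terms are a linear function of \<open>q - q0\<close> times a function that is continuous at \<open>q0\<close> (or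
  the linear function vanishes because \<open>q0\<close> is real), so \<open>f\<close> is differentiable at \<open>q0\<close> and its
  differential can be read off (\<open>regular_has_derivative\<close>). On \<open>1\<close> and \<open>I\<close>, which commute with \<open>q0\<close>,
  it is \<open>v \<mapsto> v r(q0)\<close>. On a vector \<open>v\<close> anticommuting with \<open>I\<close>, such as \<open>J\<close> and \<open>I J\<close>, the commutator
  is \<open>- 2 v (Im q0)\<close>, and the value collapses to \<open>v r(cnj q0)\<close> (\<open>derivative_orthogonal_direction\<close>).
  Multiplication of \<open>r(q0)\<close> or \<open>J r(cnj q0)\<close> by \<open>I\<close> from the left gives the value in the second real
  direction of each complex variable, so all \<open>dbar\<close> derivatives vanish; splitting \<open>r(q0)\<close> and
  \<open>J r(cnj q0)\<close> into their components in \<open>L_I\<close> and \<open>L_I J\<close> gives the second matrix.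

  What makes the regular product computable pointwise is the representation by stem functions: a
  function is regular if and only if \<open>f (x + y K) = A (x, y) + K B (x, y)\<close> for all imaginary units
  \<open>K\<close>, where \<open>A\<close> is even and \<open>B\<close> odd in \<open>y\<close> and the pair satisfies the Cauchy-Riemann equations
  (\<open>regular_has_stem\<close>, \<open>has_stem_imp_regular\<close>). This follows from the identity theorem for
  holomorphic functions on each slice. In terms of stems the regular product is multiplication of
  \<open>A + i B\<close> and \<open>C + i D\<close> with a formal imaginary unit \<open>i\<close> that commutes with all quaternions
  (\<open>is_regular_product_iff_stem\<close>); in particular it exists and depends neither on the slice nor on
  the splitting that is used to define it. The existence of \<open>r\<close> follows from the theorem on
  removable singularities, applied to the difference quotient of \<open>f\<close> at \<open>q0\<close> on the slice of \<open>I\<close>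
  (\<open>slice_difference_quotient\<close>).
\<close>

section \<open>Quaternion algebra on a slice\<close>

lemma imag_units_iff:
  "K \<in> imag_units \<longleftrightarrow> qre K = 0 \<and> (qim1 K)\<^sup>2 + (qim2 K)\<^sup>2 + (qim3 K)\<^sup>2 = 1"
proof
  assume "K \<in> imag_units"
  then have K: "qre K * qre K - qim1 K * qim1 K - qim2 K * qim2 K - qim3 K * qim3 K = -1"
    "qre K * qim1 K = 0" "qre K * qim2 K = 0" "qre K * qim3 K = 0"
    by (auto simp add: imag_units_def power2_eq_square quat_eq_iff)
  have "qre K = 0"
  proof (rule ccontr)
    assume "qre K \<noteq> 0"
    with K have "qre K * qre K = -1"
      by simp
    then show False
      using zero_le_square[of "qre K"] by linarith
  qed
  with K(1) show "qre K = 0 \<and> (qim1 K)\<^sup>2 + (qim2 K)\<^sup>2 + (qim3 K)\<^sup>2 = 1"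
    by (simp add: power2_eq_square)
next
  assume "qre K = 0 \<and> (qim1 K)\<^sup>2 + (qim2 K)\<^sup>2 + (qim3 K)\<^sup>2 = 1"
  then show "K \<in> imag_units"
    by (simp add: imag_units_def power2_eq_square quat_eq_iff)
qed

lemma imag_unit_square:
  assumes "K \<in> imag_units"
  shows "K * K = -1" "K * (K * q) = - q"
  using assms by (simp_all add: imag_units_def power2_eq_square flip: mult.assoc)

lemma norm_imag_unit: "K \<in> imag_units \<Longrightarrow> norm K = 1"
  by (simp add: imag_units_iff norm_quat_def inner_quat_def power2_eq_square)

lemma imag_units_uminus: "K \<in> imag_units \<Longrightarrow> - K \<in> imag_units"
  by (simp add: imag_units_def)

lemma orthogonal_units_anticommute:
  assumes "orthogonal_units I J"
  shows "J * I = - (I * J)"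
proof -
  have "qim1 I * qim1 J + qim2 I * qim2 J + qim3 I * qim3 J = 0" "qre I = 0" "qre J = 0"
    using assms by (auto simp add: orthogonal_units_def imag_units_iff inner_quat_def)
  then show ?thesis
    by (simp add: quat_eq_iff)
qed

lemma slice_pt_eq: "slice_pt K x y = x *\<^sub>R 1 + y *\<^sub>R K"
  by (simp add: slice_pt_def quat_eq_iff)

lemma slice_pt_uminus: "slice_pt (- K) x y = slice_pt K x (- y)"
  by (simp add: slice_pt_eq)

lemma qcnj_slice_pt: "K \<in> imag_units \<Longrightarrow> qcnj (slice_pt K x y) = slice_pt K x (- y)"
  by (simp add: slice_pt_eq imag_units_iff quat_eq_iff)

lemma slice_pt_in_slice [simp]: "slice_pt K x y \<in> slice K"
  by (auto simp: slice_def)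

lemma slice_commute: "w \<in> slice K \<Longrightarrow> w * K = K * w"
  by (auto simp: slice_def slice_pt_eq algebra_simps)

definition qim :: "quat \<Rightarrow> quat" where
  "qim q = Quat 0 (qim1 q) (qim2 q) (qim3 q)"

lemma quat_sel_qim [simp]:
  "qre (qim q) = 0" "qim1 (qim q) = qim1 q" "qim2 (qim q) = qim2 q" "qim3 (qim q) = qim3 q"
  by (simp_all add: qim_def)

lemma bounded_linear_qim: "bounded_linear qim"
  by (rule linear_conv_bounded_linear[THEN iffD1], rule linearI) (simp_all add: quat_eq_iff)

lemma bounded_linear_qre: "bounded_linear qre"
  by (rule linear_conv_bounded_linear[THEN iffD1], rule linearI) simp_all

lemma bounded_linear_qcnj: "bounded_linear qcnj"
  by (rule linear_conv_bounded_linear[THEN iffD1], rule linearI) (simp_all add: quat_eq_iff)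

lemma qre_slice_pt: "K \<in> imag_units \<Longrightarrow> qre (slice_pt K x y) = x"
  by (simp add: slice_pt_eq imag_units_iff)

lemma qim_slice_pt: "K \<in> imag_units \<Longrightarrow> qim (slice_pt K x y) = y *\<^sub>R K"
  by (simp add: slice_pt_eq imag_units_iff quat_eq_iff)

lemma sgn_qim_in_imag_units:
  assumes "qim q \<noteq> 0"
  shows "sgn (qim q) \<in> imag_units"
proof -
  define n where "n = norm (qim q)"
  have "n \<noteq> 0"
    using assms by (simp add: n_def)
  moreover have "n\<^sup>2 = (qim1 q)\<^sup>2 + (qim2 q)\<^sup>2 + (qim3 q)\<^sup>2"
    by (simp add: n_def power2_norm_eq_inner) (simp add: inner_quat_def power2_eq_square)
  ultimately show ?thesis
    by (simp add: imag_units_iff sgn_div_norm power_mult_distrib flip: distrib_left n_def)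
       (metis left_inverse power_inverse power_not_zero)
qed

text \<open>
  A real quaternion lies on every slice; the unit \<open>I\<close> in the hypothesis only provides some \<open>K\<close> in
  that case.
\<close>

lemma quat_slice_representation:
  assumes "I \<in> imag_units"
  obtains K where "K \<in> imag_units" "q = slice_pt K (qre q) (norm (qim q))"
proof (cases "qim q = 0")
  case True
  then have "q = slice_pt I (qre q) (norm (qim q))"
    by (simp add: slice_pt_eq quat_eq_iff)
  then show ?thesis
    using assms that by blast
next
  case False
  have "q = slice_pt (sgn (qim q)) (qre q) (norm (qim q))"
    using False by (simp add: slice_pt_eq sgn_div_norm) (simp add: quat_eq_iff)
  then show ?thesis
    using sgn_qim_in_imag_units[OF False] that by blast
qed

lemma qcnj_in_slice: "K \<in> imag_units \<Longrightarrow> w \<in> slice K \<Longrightarrow> qcnj w \<in> slice K"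
  by (auto simp: slice_def qcnj_slice_pt simp del: of_real_minus) blast

lemma uminus_in_slice: "w \<in> slice K \<Longrightarrow> - w \<in> slice K"
proof -
  have "- slice_pt K x y = slice_pt K (- x) (- y)" for x y
    by (simp add: slice_pt_eq)
  then show "w \<in> slice K \<Longrightarrow> - w \<in> slice K"
    by (auto simp: slice_def)
qed

text \<open>
  The projection onto \<open>L_I\<close> along \<open>L_I J\<close>. The formula involves only \<open>I\<close>: conjugation by \<open>I\<close> fixes
  \<open>L_I\<close> and is \<open>-1\<close> on \<open>L_I J\<close>.
\<close>

definition slice_proj :: "quat \<Rightarrow> quat \<Rightarrow> quat" where
  "slice_proj I q = (1/2) *\<^sub>R (q - I * q * I)"

lemma bounded_linear_slice_proj: "bounded_linear (slice_proj I)"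
  by (rule linear_conv_bounded_linear[THEN iffD1], rule linearI)
    (simp_all add: slice_proj_def algebra_simps)

lemma slice_proj_conv_slice_pt:
  assumes "I \<in> imag_units"
  shows "slice_proj I q = slice_pt I (qre q) (q \<bullet> I)"
proof -
  have I: "qre I = 0" "qim1 I * qim1 I + qim2 I * qim2 I + qim3 I * qim3 I = 1"
    using assms by (simp_all add: imag_units_iff power2_eq_square)
  have "I * q * I = - qcnj q - (2 * (q \<bullet> I)) *\<^sub>R I"
    unfolding quat_eq_iff inner_quat_def
    using I by (simp; intro conjI; algebra)
  then show ?thesis
    by (simp add: slice_proj_def slice_pt_eq quat_eq_iff)
qed

lemma slice_proj_in_slice: "I \<in> imag_units \<Longrightarrow> slice_proj I q \<in> slice I"
  by (simp add: slice_proj_conv_slice_pt)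

lemma slice_proj_mult_left: "w * I = I * w \<Longrightarrow> slice_proj I (w * q) = w * slice_proj I q"
  unfolding slice_proj_def by (simp add: right_diff_distrib flip: mult.assoc)

lemma slice_proj_of_slice: "I \<in> imag_units \<Longrightarrow> w \<in> slice I \<Longrightarrow> slice_proj I w = w"
  by (simp add: slice_proj_def slice_commute mult.assoc imag_unit_square scaleR_half_double)

lemma slice_mult_orthogonal_unit:
  assumes "orthogonal_units I J" "w \<in> slice I"
  shows "J * w = qcnj w * J"
proof -
  obtain x y where w: "w = slice_pt I x y"
    using assms(2) by (auto simp: slice_def)
  have "I \<in> imag_units"
    using assms(1) by (simp add: orthogonal_units_def)
  then show ?thesis
    unfolding w by (simp add: qcnj_slice_pt)
      (simp add: slice_pt_eq algebra_simps orthogonal_units_anticommute[OF assms(1)])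
qed

lemma slice_proj_mult_orthogonal_unit:
  assumes "orthogonal_units I J" "w \<in> slice I"
  shows "slice_proj I (w * J) = 0"
proof -
  have I: "I \<in> imag_units"
    using assms(1) by (simp add: orthogonal_units_def)
  have "I * (w * J) * I = I * w * (J * I)"
    by (simp add: mult.assoc)
  also have "\<dots> = - (I * w * I * J)"
    by (simp add: orthogonal_units_anticommute[OF assms(1)] mult.assoc)
  also have "I * w * I = - w"
    by (simp add: mult.assoc slice_commute[OF assms(2)] imag_unit_square[OF I])
  finally show ?thesis
    by (simp add: slice_proj_def)
qed

text \<open>
  The second component of \<open>q\<close> in \<open>L_I + L_I J\<close> is \<open>- slice_proj I (q J)\<close>: multiplication by \<open>J\<close> from
  the right exchanges the two summands, and \<open>J\<^sup>2 = -1\<close> accounts for the sign. Hence both components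
  are left \<open>L_I\<close>-linear continuous functions of \<open>q\<close>.
\<close>

lemma slice_proj_decomposition:
  assumes "orthogonal_units I J"
  shows "q = slice_proj I q + (- slice_proj I (q * J)) * J"
proof -
  have I: "I \<in> imag_units" and J: "J \<in> imag_units"
    using assms(1) by (simp_all add: orthogonal_units_def)
  have "J * (I * J) = J * - (J * I)"
    by (simp add: orthogonal_units_anticommute[OF assms])
  then have "J * (I * J) = I"
    by (simp add: imag_unit_square(2)[OF J])
  moreover have "q * J * J = - q"
    by (simp add: mult.assoc imag_unit_square[OF J])
  ultimately have "(I * (q * J) * I) * J = I * q * I" "q * J * J = - q"
    by (simp_all add: mult.assoc)
  then have "slice_proj I (q * J) * J = (1/2) *\<^sub>R (- q - I * q * I)"
    by (simp add: slice_proj_def left_diff_distrib)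
  moreover have "(1/2) *\<^sub>R (q - r) - (1/2) *\<^sub>R (- q - r) = q" for r :: quat
    by (simp add: quat_eq_iff field_simps)
  ultimately show ?thesis
    by (simp add: slice_proj_def)
qed

text \<open>
  Uniqueness of the components, which turns any given splitting of a function into the one by
  projections.
\<close>

lemma slice_split_unique:
  assumes "orthogonal_units I J" "F \<in> slice I" "G \<in> slice I"
  shows "slice_proj I (F + G * J) = F" "- slice_proj I ((F + G * J) * J) = G"
proof -
  have I: "I \<in> imag_units" and J: "J \<in> imag_units"
    using assms(1) by (simp_all add: orthogonal_units_def)
  interpret P: bounded_linear "slice_proj I"
    by (rule bounded_linear_slice_proj)
  show "slice_proj I (F + G * J) = F"
    by (simp add: P.add slice_proj_of_slice[OF I] assms slice_proj_mult_orthogonal_unit[OF assms(1)])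
  have "(F + G * J) * J = F * J - G"
    by (simp add: algebra_simps imag_unit_square[OF J])
  then show "- slice_proj I ((F + G * J) * J) = G"
    by (simp add: P.diff slice_proj_of_slice[OF I] assms slice_proj_mult_orthogonal_unit[OF assms(1)])
qed

lemma splits_onD:
  assumes "splits_on A I J f F G" "orthogonal_units I J" "q \<in> A"
  shows "F q = slice_proj I (f q)" "G q = - slice_proj I (f q * J)"
  using slice_split_unique[OF assms(2), of "F q" "G q"] assms(1,3)
  by (auto simp: splits_on_def)

lemma splits_on_slice_proj:
  assumes "orthogonal_units I J"
  shows "splits_on A I J f (\<lambda>q. slice_proj I (f q)) (\<lambda>q. - slice_proj I (f q * J))"
  unfolding splits_on_def
proof (intro ballI conjI)
  fix q
  have I: "I \<in> imag_units"
    using assms(1) by (simp_all add: orthogonal_units_def)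
  show "slice_proj I (f q) \<in> slice I"
    by (rule slice_proj_in_slice[OF I])
  have "- slice_proj I (f q * J) = slice_proj I (- (f q * J))"
    by (simp add: slice_proj_def scaleR_diff_right)
  then show "- slice_proj I (f q * J) \<in> slice I"
    using slice_proj_in_slice[OF I] by metis
  show "f q = slice_proj I (f q) + - slice_proj I (f q * J) * J"
    by (rule slice_proj_decomposition[OF assms])
qed

section \<open>Stem functions\<close>

abbreviation slice_at :: "quat \<Rightarrow> real \<times> real \<Rightarrow> quat" where
  "slice_at K z \<equiv> slice_pt K (fst z) (snd z)"

definition plane_cnj :: "real \<times> real \<Rightarrow> real \<times> real" where
  "plane_cnj z = (fst z, - snd z)"

lemma plane_cnj_simps [simp]: "fst (plane_cnj z) = fst z" "snd (plane_cnj z) = - snd z" "plane_cnj (plane_cnj z) = z"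
  by (simp_all add: plane_cnj_def)

lemma bounded_linear_plane_cnj: "bounded_linear plane_cnj"
  by (rule linear_conv_bounded_linear[THEN iffD1], rule linearI) (simp_all add: plane_cnj_def)

lemma bounded_linear_slice_at: "bounded_linear (slice_at K)"
  by (rule linear_conv_bounded_linear[THEN iffD1], rule linearI)
    (simp_all add: slice_pt_eq algebra_simps)

text \<open>
  Functions on a slice are treated as functions of the pair \<open>(x, y)\<close>, on which all slices look alike.
  The condition on \<open>D\<close> is the Cauchy-Riemann equation for the complex structure \<open>q \<mapsto> K q\<close>.
\<close>

definition left_holomorphic_at :: "quat \<Rightarrow> (real \<times> real \<Rightarrow> quat) \<Rightarrow> real \<times> real \<Rightarrow> bool" where
  "left_holomorphic_at K \<phi> z \<longleftrightarrow>
    (\<exists>D. (\<phi> has_derivative D) (at z) \<and> D (0, 1) = K * D (1, 0))"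

text \<open>
  The parity conditions make \<open>A (x, y) + K B (x, y)\<close> depend only on the point \<open>x + y K\<close>, which is also
  \<open>x + (- y) (- K)\<close>.
\<close>

definition is_stem ::
  "(real \<times> real) set \<Rightarrow> (real \<times> real \<Rightarrow> quat) \<Rightarrow> (real \<times> real \<Rightarrow> quat) \<Rightarrow> bool" where
  "is_stem S A B \<longleftrightarrow> (\<forall>z\<in>S. A (plane_cnj z) = A z \<and> B (plane_cnj z) = - B z \<and>
    (\<exists>A' B'. (A has_derivative A') (at z) \<and> (B has_derivative B') (at z) \<and>
      A' (1, 0) = B' (0, 1) \<and> A' (0, 1) = - B' (1, 0)))"

text \<open>
  The Cauchy-Riemann equations of a stem do not mention the imaginary unit, so one stem gives a
  holomorphic function on every slice.
\<close>

lemma left_holomorphic_at_stem: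
  assumes "is_stem S A B" "z \<in> S" "K \<in> imag_units"
  shows "left_holomorphic_at K (\<lambda>z. A z + K * B z) z"
proof -
  obtain A' B' where d: "(A has_derivative A') (at z)" "(B has_derivative B') (at z)"
    and cr: "A' (1, 0) = B' (0, 1)" "A' (0, 1) = - B' (1, 0)"
    using assms(1,2) by (auto simp: is_stem_def)
  have "((\<lambda>z. A z + K * B z) has_derivative (\<lambda>h. A' h + K * B' h)) (at z)"
    by (intro has_derivative_add has_derivative_mult_right d)
  moreover have "A' (0, 1) + K * B' (0, 1) = K * (A' (1, 0) + K * B' (1, 0))"
    by (simp add: cr distrib_left imag_unit_square[OF assms(3)])
  ultimately show ?thesis
    unfolding left_holomorphic_at_def by blast
qed

text \<open>
  On a single slice, the even part and \<open>- I\<close> times the odd part of a holomorphic function form a stem: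
  the equations at \<open>(x, y)\<close> and \<open>(x, - y)\<close> together separate the two components.
\<close>

lemma is_stem_of_left_holomorphic:
  assumes I: "I \<in> imag_units"
    and hol: "\<And>z. z \<in> S \<Longrightarrow> left_holomorphic_at I \<phi> z"
    and sym: "\<And>z. z \<in> S \<Longrightarrow> plane_cnj z \<in> S"
  shows "is_stem S (\<lambda>z. (1/2) *\<^sub>R (\<phi> z + \<phi> (plane_cnj z))) (\<lambda>z. (1/2) *\<^sub>R (I * (\<phi> (plane_cnj z) - \<phi> z)))"
  unfolding is_stem_def
proof (intro ballI conjI)
  fix z assume z: "z \<in> S"
  show "(1/2) *\<^sub>R (\<phi> (plane_cnj z) + \<phi> (plane_cnj (plane_cnj z))) = (1/2) *\<^sub>R (\<phi> z + \<phi> (plane_cnj z))"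
    by (simp add: add.commute)
  show "(1/2) *\<^sub>R (I * (\<phi> (plane_cnj (plane_cnj z)) - \<phi> (plane_cnj z))) =
      - ((1/2) *\<^sub>R (I * (\<phi> (plane_cnj z) - \<phi> z)))"
    by (simp add: algebra_simps)
  obtain D where D: "(\<phi> has_derivative D) (at z)" "D (0, 1) = I * D (1, 0)"
    using hol[OF z] by (auto simp: left_holomorphic_at_def)
  obtain E where E: "(\<phi> has_derivative E) (at (plane_cnj z))" "E (0, 1) = I * E (1, 0)"
    using hol[OF sym[OF z]] by (auto simp: left_holomorphic_at_def)
  have E': "((\<lambda>z. \<phi> (plane_cnj z)) has_derivative (\<lambda>h. E (plane_cnj h))) (at z)"
    by (rule has_derivative_compose[OF bounded_linear_imp_has_derivative[OF bounded_linear_plane_cnj] E(1)])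
  have Em: "E (0, -1) = - E (0, 1)"
    using linear_neg[OF has_derivative_linear[OF E(1)], of "(0, 1)"] by simp
  let ?A' = "\<lambda>h. (1/2) *\<^sub>R (D h + E (plane_cnj h))"
  let ?B' = "\<lambda>h. (1/2) *\<^sub>R (I * (E (plane_cnj h) - D h))"
  have "((\<lambda>z. (1/2) *\<^sub>R (\<phi> z + \<phi> (plane_cnj z))) has_derivative ?A') (at z)"
    by (intro has_derivative_scaleR_right has_derivative_add D(1) E')
  moreover have "((\<lambda>z. (1/2) *\<^sub>R (I * (\<phi> (plane_cnj z) - \<phi> z))) has_derivative ?B') (at z)"
    by (intro has_derivative_scaleR_right has_derivative_mult_right has_derivative_diff D(1) E')
  moreover have "?A' (1, 0) = ?B' (0, 1)" "?A' (0, 1) = - ?B' (1, 0)"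
    by (simp_all add: plane_cnj_def Em D(2) E(2) algebra_simps imag_unit_square[OF I])
  ultimately show "\<exists>A' B'. ((\<lambda>z. (1/2) *\<^sub>R (\<phi> z + \<phi> (plane_cnj z))) has_derivative A') (at z) \<and>
      ((\<lambda>z. (1/2) *\<^sub>R (I * (\<phi> (plane_cnj z) - \<phi> z))) has_derivative B') (at z) \<and>
      A' (1, 0) = B' (0, 1) \<and> A' (0, 1) = - B' (1, 0)"
    by (intro exI[of _ ?A'] exI[of _ ?B'] conjI)
qed

lemma left_holomorphic_at_diff:
  assumes "left_holomorphic_at K \<phi> z" "left_holomorphic_at K \<psi> z"
  shows "left_holomorphic_at K (\<lambda>z. \<phi> z - \<psi> z) z"
proof -
  obtain D E where D: "(\<phi> has_derivative D) (at z)" "D (0, 1) = K * D (1, 0)"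
    and E: "(\<psi> has_derivative E) (at z)" "E (0, 1) = K * E (1, 0)"
    using assms by (auto simp: left_holomorphic_at_def)
  have "((\<lambda>z. \<phi> z - \<psi> z) has_derivative (\<lambda>h. D h - E h)) (at z)"
    by (intro has_derivative_diff D E)
  then show ?thesis
    unfolding left_holomorphic_at_def
    by (rule exI[of _ "\<lambda>h. D h - E h", OF conjI]) (simp add: D(2) E(2) right_diff_distrib)
qed

lemma left_holomorphic_at_linear:
  assumes "left_holomorphic_at K \<phi> z" "bounded_linear L" "\<And>q. L (K * q) = K * L q"
  shows "left_holomorphic_at K (\<lambda>z. L (\<phi> z)) z"
proof -
  obtain D where D: "(\<phi> has_derivative D) (at z)" "D (0, 1) = K * D (1, 0)"
    using assms(1) by (auto simp: left_holomorphic_at_def)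
  have "((\<lambda>z. L (\<phi> z)) has_derivative (\<lambda>h. L (D h))) (at z)"
    by (rule bounded_linear.has_derivative[OF assms(2) D(1)])
  then show ?thesis
    unfolding left_holomorphic_at_def
    by (rule exI[of _ "\<lambda>h. L (D h)", OF conjI]) (simp add: D(2) assms(3))
qed

lemma even_odd_parts:
  assumes "I \<in> imag_units"
  shows "p = (1/2) *\<^sub>R (p + q) + I * ((1/2) *\<^sub>R (I * (q - p)))"
proof -
  have "(1/2) *\<^sub>R (p + q) + (1/2) *\<^sub>R (p - q) = p"
    by (simp add: quat_eq_iff field_simps)
  then show ?thesis
    by (simp add: imag_unit_square[OF assms])
qed

lemma is_stem_mult:
  assumes "is_stem S A B" "is_stem S C D"
  shows "is_stem S (\<lambda>z. A z * C z - B z * D z) (\<lambda>z. A z * D z + B z * C z)"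
  unfolding is_stem_def
proof (intro ballI conjI)
  fix z assume z: "z \<in> S"
  have p: "A (plane_cnj z) = A z" "B (plane_cnj z) = - B z" "C (plane_cnj z) = C z" "D (plane_cnj z) = - D z"
    using assms z by (auto simp: is_stem_def)
  show "A (plane_cnj z) * C (plane_cnj z) - B (plane_cnj z) * D (plane_cnj z) = A z * C z - B z * D z"
    "A (plane_cnj z) * D (plane_cnj z) + B (plane_cnj z) * C (plane_cnj z) = - (A z * D z + B z * C z)"
    by (simp_all add: p)
  obtain A' B' where AB: "(A has_derivative A') (at z)" "(B has_derivative B') (at z)"
    "A' (1, 0) = B' (0, 1)" "A' (0, 1) = - B' (1, 0)"
    using assms(1) z by (auto simp: is_stem_def)
  obtain C' D' where CD: "(C has_derivative C') (at z)" "(D has_derivative D') (at z)"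
    "C' (1, 0) = D' (0, 1)" "C' (0, 1) = - D' (1, 0)"
    using assms(2) z by (auto simp: is_stem_def)
  let ?P' = "\<lambda>h. (A z * C' h + A' h * C z) - (B z * D' h + B' h * D z)"
  let ?Q' = "\<lambda>h. (A z * D' h + A' h * D z) + (B z * C' h + B' h * C z)"
  have "((\<lambda>z. A z * C z - B z * D z) has_derivative ?P') (at z)"
    "((\<lambda>z. A z * D z + B z * C z) has_derivative ?Q') (at z)"
    by (intro has_derivative_add has_derivative_diff has_derivative_mult AB CD)+
  moreover have "?P' (1, 0) = ?Q' (0, 1)" "?P' (0, 1) = - ?Q' (1, 0)"
    by (simp_all add: AB CD)
  ultimately show "\<exists>P' Q'. ((\<lambda>z. A z * C z - B z * D z) has_derivative P') (at z) \<and>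
      ((\<lambda>z. A z * D z + B z * C z) has_derivative Q') (at z) \<and>
      P' (1, 0) = Q' (0, 1) \<and> P' (0, 1) = - Q' (1, 0)"
    by (intro exI[of _ ?P'] exI[of _ ?Q'] conjI)
qed

section \<open>Complex coordinates and the identity theorem on a slice\<close>

definition plane_of_complex :: "complex \<Rightarrow> real \<times> real" where
  "plane_of_complex w = (Re w, Im w)"

lemma bounded_linear_plane_of_complex: "bounded_linear plane_of_complex"
  by (rule linear_conv_bounded_linear[THEN iffD1], rule linearI) (simp_all add: plane_of_complex_def)

lemma open_plane_of_complex_vimage: "open S \<Longrightarrow> open (plane_of_complex -` S)"
  by (rule open_vimage) (simp_all add: linear_continuous_on bounded_linear_plane_of_complex)

text \<open>
  The only complex-valued function \<open>c\<close> with real part \<open>q \<mapsto> v \<bullet> q\<close> that satisfies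
  \<open>c (K q) = \<i> c q\<close>. Composing with it turns left holomorphic functions into holomorphic ones, and
  the functions for all \<open>v\<close> separate points.
\<close>

definition complex_coord :: "quat \<Rightarrow> quat \<Rightarrow> quat \<Rightarrow> complex" where
  "complex_coord K v q = Complex (v \<bullet> q) (- (v \<bullet> (K * q)))"

lemma bounded_linear_complex_coord: "bounded_linear (complex_coord K v)"
  by (rule linear_conv_bounded_linear[THEN iffD1], rule linearI)
    (simp_all add: complex_coord_def complex_eq_iff inner_add_right distrib_left)

lemma complex_coord_mult_unit: "K \<in> imag_units \<Longrightarrow> complex_coord K v (K * q) = \<i> * complex_coord K v q"
  by (simp add: complex_coord_def complex_eq_iff imag_unit_square)

lemma holomorphic_complex_coord:
  assumes K: "K \<in> imag_units" and hol: "\<And>z. z \<in> S \<Longrightarrow> left_holomorphic_at K \<phi> z" and "open S"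
  shows "(\<lambda>w. complex_coord K v (\<phi> (plane_of_complex w))) holomorphic_on (plane_of_complex -` S)"
proof -
  interpret c: bounded_linear "complex_coord K v"
    by (rule bounded_linear_complex_coord)
  have "((\<lambda>w. complex_coord K v (\<phi> (plane_of_complex w))) field_differentiable (at w within plane_of_complex -` S))"
    if "w \<in> plane_of_complex -` S" for w
  proof -
    obtain D where D: "(\<phi> has_derivative D) (at (plane_of_complex w))" "D (0, 1) = K * D (1, 0)"
      using hol[of "plane_of_complex w"] \<open>w \<in> plane_of_complex -` S\<close> by (auto simp: left_holomorphic_at_def)
    interpret D: bounded_linear D
      by (rule has_derivative_bounded_linear[OF D(1)])
    have "((\<lambda>w. complex_coord K v (\<phi> (plane_of_complex w))) has_derivative (\<lambda>h. complex_coord K v (D (plane_of_complex h)))) (at w)"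
      by (rule bounded_linear.has_derivative[OF bounded_linear_complex_coord]
          has_derivative_compose[OF bounded_linear_imp_has_derivative[OF bounded_linear_plane_of_complex]] D(1))+
    moreover have "complex_coord K v (D (plane_of_complex h)) = complex_coord K v (D (1, 0)) * h" for h
    proof -
      have "plane_of_complex h = Re h *\<^sub>R (1, 0) + Im h *\<^sub>R (0, 1)"
        by (simp add: plane_of_complex_def)
      then have "D (plane_of_complex h) = Re h *\<^sub>R D (1, 0) + Im h *\<^sub>R (K * D (1, 0))"
        by (simp only: D.add D.scaleR D(2))
      then show ?thesis
        by (simp add: c.add c.scaleR complex_coord_mult_unit[OF K] complex_eq_iff algebra_simps)
    qed
    ultimately have "((\<lambda>w. complex_coord K v (\<phi> (plane_of_complex w))) has_field_derivative complex_coord K v (D (1, 0))) (at w)"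
      by (simp add: has_field_derivative_def)
    then show ?thesis
      using field_differentiable_at_within field_differentiable_def by blast
  qed
  then show ?thesis
    by (simp add: holomorphic_on_def)
qed

lemma left_holomorphic_of_holomorphic:
  assumes K: "K \<in> imag_units" and "c holomorphic_on (plane_of_complex -` S)" "open S" "z \<in> S"
  shows "left_holomorphic_at K (\<lambda>z. slice_at K (plane_of_complex (c (Complex (fst z) (snd z))))) z"
proof -
  have bl: "bounded_linear (\<lambda>z. Complex (fst z) (snd z))"
    by (rule linear_conv_bounded_linear[THEN iffD1], rule linearI) (simp_all add: complex_eq_iff)
  have bl2: "bounded_linear (\<lambda>w. slice_at K (plane_of_complex w))"
    by (rule bounded_linear_compose[OF bounded_linear_slice_at bounded_linear_plane_of_complex])
  let ?w = "Complex (fst z) (snd z)"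
  have "?w \<in> plane_of_complex -` S"
    using assms(4) by (simp add: plane_of_complex_def)
  then have "(c has_field_derivative deriv c ?w) (at ?w)"
    using holomorphic_derivI assms(2) open_plane_of_complex_vimage[OF assms(3)] by blast
  then have d: "(c has_derivative (*) (deriv c ?w)) (at ?w)"
    by (simp add: has_field_derivative_def)
  let ?D = "\<lambda>h. slice_at K (plane_of_complex (deriv c ?w * Complex (fst h) (snd h)))"
  have "((\<lambda>z. slice_at K (plane_of_complex (c (Complex (fst z) (snd z))))) has_derivative ?D) (at z)"
    by (rule bounded_linear.has_derivative[OF bl2]
        has_derivative_compose[OF bounded_linear_imp_has_derivative[OF bl]] d)+
  moreover have "?D (0, 1) = K * ?D (1, 0)"
    by (simp add: slice_pt_eq plane_of_complex_def algebra_simps imag_unit_square[OF K])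
  ultimately show ?thesis
    unfolding left_holomorphic_at_def by blast
qed

text \<open>
  The identity theorem: each complex coordinate of \<open>\<phi>\<close> is holomorphic and vanishes on an interval of
  the real axis.
\<close>

lemma left_holomorphic_identity:
  assumes K: "K \<in> imag_units" and hol: "\<And>z. z \<in> S \<Longrightarrow> left_holomorphic_at K \<phi> z"
    and S: "open S" "connected S" and x: "(x, 0) \<in> S"
    and zero: "\<And>t. (t, 0) \<in> S \<Longrightarrow> \<phi> (t, 0) = 0" and z: "z \<in> S"
  shows "\<phi> z = 0"
proof -
  define T where "T = plane_of_complex -` S"
  have T: "open T"
    unfolding T_def by (rule open_plane_of_complex_vimage[OF S(1)])
  have "T = (\<lambda>z. Complex (fst z) (snd z)) ` S"
    by (force simp: T_def plane_of_complex_def image_iff)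
  moreover have "continuous_on S (\<lambda>z. Complex (fst z) (snd z))"
    by (intro continuous_intros)
  ultimately have "connected T"
    using connected_continuous_image S(2) by metis
  let ?U = "{w \<in> T. Im w = 0}"
  have xT: "of_real x \<in> T"
    using x by (simp add: T_def plane_of_complex_def)
  have lim: "of_real x islimpt ?U"
    unfolding islimpt_approachable
  proof (intro allI impI)
    fix e :: real assume "e > 0"
    obtain d where d: "d > 0" "ball (of_real x) d \<subseteq> T"
      using T xT open_contains_ball by blast
    let ?w = "complex_of_real (x + min (d/2) (e/2))"
    have "dist ?w (of_real x) = min (d/2) (e/2)"
      using \<open>d > 0\<close> \<open>e > 0\<close> by (simp add: dist_norm)
    then have "dist ?w (of_real x) < e" "dist (of_real x) ?w < d"
      using \<open>d > 0\<close> \<open>e > 0\<close> by (simp_all add: dist_commute min_def)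
    moreover have "?w \<noteq> of_real x"
      using \<open>d > 0\<close> \<open>e > 0\<close> by (simp only: of_real_eq_iff)
    ultimately show "\<exists>w'\<in>?U. w' \<noteq> of_real x \<and> dist w' (of_real x) < e"
      using d(2) by (intro bexI[of _ ?w]) auto
  qed
  have "complex_coord K v (\<phi> z) = 0" for v
  proof -
    let ?c = "\<lambda>w. complex_coord K v (\<phi> (plane_of_complex w))"
    have "?c (Complex (fst z) (snd z)) = 0"
    proof (rule analytic_continuation[of ?c T ?U "of_real x"])
      show "?c holomorphic_on T"
        unfolding T_def by (rule holomorphic_complex_coord[OF K hol S(1)])
      show "?c w = 0" if "w \<in> ?U" for w
        using that zero[of "Re w"] linear_0[OF bounded_linear.linear[OF bounded_linear_complex_coord]]
        by (auto simp: T_def plane_of_complex_def)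
    qed (use T \<open>connected T\<close> xT lim z in \<open>auto simp: T_def plane_of_complex_def\<close>)
    then show ?thesis
      by (simp add: plane_of_complex_def)
  qed
  from this[of "\<phi> z"] show ?thesis
    by (simp add: complex_coord_def complex_eq_iff)
qed

text \<open>
  A function with values in the slice of \<open>K\<close> is a single holomorphic function of one complex variable,
  whose difference quotient extends holomorphically over \<open>z0\<close>.
\<close>

lemma slice_difference_quotient_slice_valued:
  assumes K: "K \<in> imag_units" and hol: "\<And>z. z \<in> S \<Longrightarrow> left_holomorphic_at K \<phi> z"
    and S: "open S" and val: "\<And>z. z \<in> S \<Longrightarrow> \<phi> z \<in> slice K" and z0: "z0 \<in> S"
  obtains \<rho> where "\<And>z. z \<in> S \<Longrightarrow> left_holomorphic_at K \<rho> z"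
    "\<And>z. z \<in> S \<Longrightarrow> \<phi> z = \<phi> z0 + (slice_at K z - slice_at K z0) * \<rho> z"
proof -
  let ?cx = "\<lambda>z. Complex (fst z) (snd z)"
  define c where "c w = complex_coord K 1 (\<phi> (plane_of_complex w))" for w
  define w0 where "w0 = ?cx z0"
  define d where "d w = (if w = w0 then deriv c w0 else (c w - c w0) / (w - w0))" for w
  define \<rho> where "\<rho> z = slice_at K (plane_of_complex (d (?cx z)))" for z
  have "c holomorphic_on (plane_of_complex -` S)"
    unfolding c_def by (rule holomorphic_complex_coord[OF K hol S])
  then have d: "d holomorphic_on (plane_of_complex -` S)"
    unfolding d_def by (rule pole_lemma_open[OF _ open_plane_of_complex_vimage[OF S]])
  have dq: "c w = c w0 + (w - w0) * d w" for w
    by (simp add: d_def)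
  have mult: "slice_at K (plane_of_complex (v * w)) = slice_at K (plane_of_complex v) * slice_at K (plane_of_complex w)" for v w
    by (simp add: slice_pt_eq plane_of_complex_def algebra_simps imag_unit_square[OF K])
  \<comment> \<open>The coordinate \<open>complex_coord K 1\<close> inverts the embedding of the complex numbers as \<open>L_K\<close>.\<close>
  have c: "slice_at K (plane_of_complex (c (?cx z))) = \<phi> z" if "z \<in> S" for z
  proof -
    have "- qre (K * \<phi> z) = \<phi> z \<bullet> K"
      using K by (simp add: imag_units_iff inner_quat_def)
    moreover have "(1::quat) \<bullet> q = qre q" for q
      by (simp add: inner_quat_def)
    ultimately have "slice_at K (plane_of_complex (c (?cx z))) = slice_proj K (\<phi> z)"
      by (simp add: slice_proj_conv_slice_pt[OF K] c_def complex_coord_def plane_of_complex_def)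
    then show ?thesis
      using slice_proj_of_slice[OF K val[OF that]] by simp
  qed
  interpret slice_at: bounded_linear "\<lambda>w. slice_at K (plane_of_complex w)"
    by (rule bounded_linear_compose[OF bounded_linear_slice_at bounded_linear_plane_of_complex])
  show ?thesis
  proof (rule that)
    fix z assume z: "z \<in> S"
    show "left_holomorphic_at K \<rho> z"
      unfolding \<rho>_def by (rule left_holomorphic_of_holomorphic[OF K d S z])
    have "\<phi> z = slice_at K (plane_of_complex (c w0 + (?cx z - w0) * d (?cx z)))"
      using c[OF z] dq by metis
    also have "\<dots> = \<phi> z0 + (slice_at K z - slice_at K z0) * \<rho> z"
      using c[OF z0] by (simp only: slice_at.add slice_at.diff mult w0_def \<rho>_def) (simp add: plane_of_complex_def)
    finally show "\<phi> z = \<phi> z0 + (slice_at K z - slice_at K z0) * \<rho> z" .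
  qed
qed

text \<open>
  The general case follows by treating the two components in \<open>L_I + L_I J\<close> separately.
\<close>

lemma slice_difference_quotient:
  assumes IJ: "orthogonal_units I J" and hol: "\<And>z. z \<in> S \<Longrightarrow> left_holomorphic_at I \<phi> z"
    and S: "open S" and z0: "z0 \<in> S"
  obtains \<rho> where "\<And>z. z \<in> S \<Longrightarrow> left_holomorphic_at I \<rho> z"
    "\<And>z. z \<in> S \<Longrightarrow> \<phi> z = \<phi> z0 + (slice_at I z - slice_at I z0) * \<rho> z"
proof -
  have I: "I \<in> imag_units"
    using IJ by (simp add: orthogonal_units_def)
  let ?P = "slice_proj I" and ?Q = "\<lambda>q. slice_proj I (q * - J)"
  have PQ: "bounded_linear ?P" "bounded_linear ?Q" "bounded_linear (\<lambda>q. q * J)"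
    by (intro bounded_linear_compose[OF bounded_linear_slice_proj] bounded_linear_slice_proj
        bounded_linear_mult_left)+
  have split: "q = ?P q + ?Q q * J" for q
    using slice_proj_decomposition[OF IJ, of q]
    by (simp add: linear_neg[OF bounded_linear.linear[OF bounded_linear_slice_proj]])
  have lin: "?P (I * q) = I * ?P q" "?Q (I * q) = I * ?Q q" for q
    by (simp_all add: slice_proj_mult_left mult.assoc del: mult_minus_right)
  have holPQ: "left_holomorphic_at I (\<lambda>z. ?P (\<phi> z)) z" "left_holomorphic_at I (\<lambda>z. ?Q (\<phi> z)) z"
    if "z \<in> S" for z
    by (intro left_holomorphic_at_linear[OF hol[OF that]] PQ lin)+
  obtain \<rho>1 where 1: "\<And>z. z \<in> S \<Longrightarrow> left_holomorphic_at I \<rho>1 z"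
    "\<And>z. z \<in> S \<Longrightarrow> ?P (\<phi> z) = ?P (\<phi> z0) + (slice_at I z - slice_at I z0) * \<rho>1 z"
    using slice_difference_quotient_slice_valued[OF I holPQ(1) S slice_proj_in_slice[OF I] z0] by metis
  obtain \<rho>2 where 2: "\<And>z. z \<in> S \<Longrightarrow> left_holomorphic_at I \<rho>2 z"
    "\<And>z. z \<in> S \<Longrightarrow> ?Q (\<phi> z) = ?Q (\<phi> z0) + (slice_at I z - slice_at I z0) * \<rho>2 z"
    using slice_difference_quotient_slice_valued[OF I holPQ(2) S slice_proj_in_slice[OF I] z0] by metis
  show ?thesis
  proof (rule that)
    fix z assume z: "z \<in> S"
    have "left_holomorphic_at I (\<lambda>z. \<rho>2 z * - J) z"
      by (rule left_holomorphic_at_linear[OF 2(1)[OF z]])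
        (simp_all add: bounded_linear_mult_left mult.assoc del: mult_minus_right)
    from left_holomorphic_at_diff[OF 1(1)[OF z] this]
    show "left_holomorphic_at I (\<lambda>z. \<rho>1 z + \<rho>2 z * J) z"
      by simp
    have "\<phi> z = ?P (\<phi> z) + ?Q (\<phi> z) * J"
      by (rule split)
    also have "\<dots> = (?P (\<phi> z0) + ?Q (\<phi> z0) * J) + (slice_at I z - slice_at I z0) * (\<rho>1 z + \<rho>2 z * J)"
      by (simp only: 1(2)[OF z] 2(2)[OF z] distrib_left distrib_right mult.assoc)
        (simp only: ac_simps)
    also have "?P (\<phi> z0) + ?Q (\<phi> z0) * J = \<phi> z0"
      by (rule split[symmetric])
    finally show "\<phi> z = \<phi> z0 + (slice_at I z - slice_at I z0) * (\<rho>1 z + \<rho>2 z * J)" .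
  qed
qed

section \<open>Regular functions and their stem functions\<close>

text \<open>
  For a symmetric set, the choice of \<open>K\<close> does not matter.
\<close>

definition stem_domain :: "quat set \<Rightarrow> (real \<times> real) set" where
  "stem_domain \<Omega> = {z. \<exists>K\<in>imag_units. slice_at K z \<in> \<Omega>}"

definition has_stem ::
  "quat set \<Rightarrow> (quat \<Rightarrow> quat) \<Rightarrow> (real \<times> real \<Rightarrow> quat) \<Rightarrow> (real \<times> real \<Rightarrow> quat) \<Rightarrow> bool" where
  "has_stem \<Omega> f A B \<longleftrightarrow> is_stem (stem_domain \<Omega>) A B \<and>
    (\<forall>K\<in>imag_units. \<forall>z\<in>stem_domain \<Omega>. f (slice_at K z) = A z + K * B z)"

lemma has_stemD:
  assumes "has_stem \<Omega> f A B" "z \<in> stem_domain \<Omega>"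
  shows "K \<in> imag_units \<Longrightarrow> f (slice_at K z) = A z + K * B z"
    "A (plane_cnj z) = A z" "B (plane_cnj z) = - B z"
  using assms by (auto simp: has_stem_def is_stem_def)

lemma CR_operator_zero_iff:
  assumes "K \<in> imag_units"
  shows "p + K * q = 0 \<longleftrightarrow> q = K * p"
proof
  assume "p + K * q = 0"
  then have "p = - (K * q)"
    by (simp add: add_eq_0_iff2)
  then show "q = K * p"
    by (simp add: imag_unit_square[OF assms])
next
  assume "q = K * p"
  then show "p + K * q = 0"
    by (simp add: imag_unit_square[OF assms])
qed

locale symmetric_slice_domain =
  fixes \<Omega> :: "quat set"
  assumes slice_domain: "slice_domain \<Omega>" and symmetric: "symmetric_set \<Omega>"
begin

lemma open_domain: "open \<Omega>"
  using slice_domain by (simp add: slice_domain_def)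

lemma stem_domain_iff:
  assumes "K \<in> imag_units"
  shows "z \<in> stem_domain \<Omega> \<longleftrightarrow> slice_at K z \<in> \<Omega>"
  using assms symmetric unfolding stem_domain_def symmetric_set_def by blast

lemma plane_cnj_stem_domain:
  assumes "z \<in> stem_domain \<Omega>"
  shows "plane_cnj z \<in> stem_domain \<Omega>"
proof -
  obtain K where K: "K \<in> imag_units" "slice_at K z \<in> \<Omega>"
    using assms by (auto simp: stem_domain_def)
  then have "slice_at (- K) (plane_cnj z) \<in> \<Omega>"
    by (simp add: slice_pt_uminus)
  then show ?thesis
    using stem_domain_iff[OF imag_units_uminus[OF K(1)]] by simp
qed

lemma qcnj_in_domain:
  assumes "K \<in> imag_units" "q \<in> \<Omega>"
  shows "qcnj q \<in> \<Omega>"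
proof -
  obtain L where L: "L \<in> imag_units" "q = slice_pt L (qre q) (norm (qim q))"
    using quat_slice_representation[OF assms(1)] by blast
  then have "(qre q, norm (qim q)) \<in> stem_domain \<Omega>"
    using stem_domain_iff[OF L(1)] assms(2) by simp
  then have "slice_at L (plane_cnj (qre q, norm (qim q))) \<in> \<Omega>"
    using plane_cnj_stem_domain stem_domain_iff[OF L(1)] by blast
  then show ?thesis
    by (metis L plane_cnj_simps(1,2) qcnj_slice_pt fst_conv snd_conv)
qed

lemma open_stem_domain:
  assumes "K \<in> imag_units"
  shows "open (stem_domain \<Omega>)"
proof -
  have "stem_domain \<Omega> = slice_at K -` \<Omega>"
    using stem_domain_iff[OF assms] by blast
  then show ?thesis
    using open_vimage[OF open_domain linear_continuous_on[OF bounded_linear_slice_at]] by simp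
qed

text \<open>
  The coordinates \<open>(x, y)\<close> identify each slice of \<open>\<Omega>\<close> with the stem domain, so connectedness of the
  slices makes the identity theorem applicable there.
\<close>

lemma connected_stem_domain:
  assumes K: "K \<in> imag_units"
  shows "connected (stem_domain \<Omega>)"
proof -
  have eq: "stem_domain \<Omega> = (\<lambda>q. (qre q, q \<bullet> K)) ` (\<Omega> \<inter> slice K)"
  proof (intro set_eqI iffI)
    fix z assume "z \<in> stem_domain \<Omega>"
    moreover have "z = (qre (slice_at K z), slice_at K z \<bullet> K)"
    proof -
      have "K \<bullet> K = 1" "(1::quat) \<bullet> K = 0"
        using K norm_imag_unit[OF K] by (simp add: dot_square_norm)
          (use K in \<open>simp add: imag_units_iff inner_quat_def\<close>)
      then show ?thesis
        by (simp add: qre_slice_pt[OF K]) (simp add: slice_pt_eq inner_add_left)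
    qed
    ultimately show "z \<in> (\<lambda>q. (qre q, q \<bullet> K)) ` (\<Omega> \<inter> slice K)"
      using stem_domain_iff[OF K] by (intro image_eqI[of _ _ "slice_at K z"]) simp_all
  next
    fix z assume "z \<in> (\<lambda>q. (qre q, q \<bullet> K)) ` (\<Omega> \<inter> slice K)"
    then obtain q where q: "q \<in> \<Omega>" "q \<in> slice K" "z = (qre q, q \<bullet> K)"
      by blast
    then have "slice_at K z = q"
      using slice_proj_conv_slice_pt[OF K, of q] slice_proj_of_slice[OF K] by simp
    then show "z \<in> stem_domain \<Omega>"
      using stem_domain_iff[OF K] q by simp
  qed
  have "connected (\<Omega> \<inter> slice K)"
    using slice_domain K by (simp add: slice_domain_def)
  then show ?thesis
    unfolding eq by (intro connected_continuous_image continuous_intros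
        bounded_linear.continuous_on[OF bounded_linear_qre])
qed

lemma real_point_in_stem_domain:
  assumes "K \<in> imag_units"
  obtains x where "(x, 0) \<in> stem_domain \<Omega>"
proof -
  obtain x where "of_real x \<in> \<Omega>"
    using slice_domain by (auto simp: slice_domain_def Reals_def)
  then show ?thesis
    using that[of x] stem_domain_iff[OF assms] by (simp add: slice_pt_def)
qed

lemma slice_holomorphic_on_iff:
  assumes "K \<in> imag_units"
  shows "slice_holomorphic_on K (\<Omega> \<inter> slice K) f \<longleftrightarrow>
    (\<forall>z\<in>stem_domain \<Omega>. left_holomorphic_at K (\<lambda>z. f (slice_at K z)) z)"
  using assms unfolding slice_holomorphic_on_def left_holomorphic_at_def Ball_def
  by (simp add: stem_domain_iff case_prod_beta' CR_operator_zero_iff)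

lemma regular_on_iff:
  "regular_on \<Omega> f \<longleftrightarrow>
    (\<forall>K\<in>imag_units. \<forall>z\<in>stem_domain \<Omega>. left_holomorphic_at K (\<lambda>z. f (slice_at K z)) z)"
  unfolding regular_on_def
  by (intro ball_cong refl) (rule slice_holomorphic_on_iff)

lemma has_stem_imp_regular:
  assumes "has_stem \<Omega> f A B"
  shows "regular_on \<Omega> f"
  unfolding regular_on_iff
proof (intro ballI)
  fix K z assume K: "K \<in> imag_units" and z: "z \<in> stem_domain \<Omega>"
  have st: "is_stem (stem_domain \<Omega>) A B"
    using assms by (simp add: has_stem_def)
  obtain D where D: "((\<lambda>z. A z + K * B z) has_derivative D) (at z)" "D (0, 1) = K * D (1, 0)"
    using left_holomorphic_at_stem[OF st z K] by (auto simp: left_holomorphic_at_def)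
  have "((\<lambda>z. f (slice_at K z)) has_derivative D) (at z)"
    by (rule has_derivative_transform_within_open[OF D(1) open_stem_domain[OF K] z])
      (simp add: has_stemD(1)[OF assms _ K])
  then show "left_holomorphic_at K (\<lambda>z. f (slice_at K z)) z"
    using D(2) by (auto simp: left_holomorphic_at_def)
qed

text \<open>
  The representation formula: the stem built from the values on the slice of \<open>I\<close> reproduces \<open>f\<close> at the
  real points of every other slice, hence on the whole slice by the identity theorem.
\<close>

lemma regular_has_stem:
  assumes "I \<in> imag_units" and f: "regular_on \<Omega> f"
  obtains A B where "has_stem \<Omega> f A B"
proof -
  let ?S = "stem_domain \<Omega>"
  let ?\<phi> = "\<lambda>z. f (slice_at I z)"
  let ?A = "\<lambda>z. (1/2) *\<^sub>R (?\<phi> z + ?\<phi> (plane_cnj z))"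
  let ?B = "\<lambda>z. (1/2) *\<^sub>R (I * (?\<phi> (plane_cnj z) - ?\<phi> z))"
  have hol: "left_holomorphic_at K (\<lambda>z. f (slice_at K z)) z" if "K \<in> imag_units" "z \<in> ?S" for K z
    using f that by (simp add: regular_on_iff)
  have st: "is_stem ?S ?A ?B"
    by (rule is_stem_of_left_holomorphic[OF assms(1) hol[OF assms(1)] plane_cnj_stem_domain])
  have "f (slice_at K z) = ?A z + K * ?B z" if K: "K \<in> imag_units" and z: "z \<in> ?S" for K z
  proof -
    obtain x where x: "(x, 0) \<in> ?S"
      using real_point_in_stem_domain[OF K] .
    have "f (slice_at K z) - (?A z + K * ?B z) = 0"
    proof (rule left_holomorphic_identity[OF K _ open_stem_domain[OF K] connected_stem_domain[OF K] x _ z])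
      fix z assume z: "z \<in> ?S"
      show "left_holomorphic_at K (\<lambda>z. f (slice_at K z) - (?A z + K * ?B z)) z"
        by (rule left_holomorphic_at_diff[OF hol[OF K z] left_holomorphic_at_stem[OF st z K]])
    next
      fix t
      have "plane_cnj (t, 0) = (t, 0)"
        by (simp add: plane_cnj_def)
      then show "f (slice_at K (t, 0)) - (?A (t, 0) + K * ?B (t, 0)) = 0"
        by (simp add: slice_pt_def scaleR_half_double)
    qed
    then show ?thesis
      by simp
  qed
  then show ?thesis
    using st that unfolding has_stem_def by blast
qed

text \<open>
  Every stem comes from a function. Non-real quaternions are written with the unit \<open>sgn (qim q)\<close> and
  positive \<open>y\<close>; at real points the convention \<open>sgn 0 = 0\<close> is harmless since \<open>B\<close> vanishes there.
\<close>

lemma is_stem_realized: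
  assumes I: "I \<in> imag_units" and st: "is_stem (stem_domain \<Omega>) A B"
  obtains f where "has_stem \<Omega> f A B"
proof -
  define f where "f q = A (qre q, norm (qim q)) + sgn (qim q) * B (qre q, norm (qim q))" for q
  have "f (slice_at K z) = A z + K * B z" if K: "K \<in> imag_units" and z: "z \<in> stem_domain \<Omega>" for K z
  proof -
    obtain x y where xy: "z = (x, y)"
      by (cases z)
    have par: "A (x, - y) = A (x, y)" "B (x, - y) = - B (x, y)"
      using st z by (auto simp: is_stem_def plane_cnj_def xy)
    have f: "f (slice_at K z) = A (x, \<bar>y\<bar>) + sgn y *\<^sub>R (K * B (x, \<bar>y\<bar>))"
      using norm_imag_unit[OF K]
      by (simp add: f_def xy qre_slice_pt[OF K] qim_slice_pt[OF K] sgn_scaleR sgn_div_norm[of K])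
    consider "y > 0" | "y = 0" | "y < 0"
      by linarith
    then show ?thesis
    proof cases
      case 2
      then have "B (x, 0) = 0"
        using par(2) by (simp add: quat_eq_iff)
      then show ?thesis
        using 2 f xy by simp
    qed (use f xy par in simp_all)
  qed
  then show ?thesis
    using st that unfolding has_stem_def by blast
qed

text \<open>
  A stem is determined on its domain by the values of the function on one slice, as the even and odd
  parts of that restriction.
\<close>

lemma has_stem_unique_on_slice:
  assumes "has_stem \<Omega> h A B" and K: "K \<in> imag_units"
    and P: "\<And>z. z \<in> stem_domain \<Omega> \<Longrightarrow> P (plane_cnj z) = P z"
    and Q: "\<And>z. z \<in> stem_domain \<Omega> \<Longrightarrow> Q (plane_cnj z) = - Q z"
    and eq: "\<And>z. z \<in> stem_domain \<Omega> \<Longrightarrow> h (slice_at K z) = P z + K * Q z"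
    and z: "z \<in> stem_domain \<Omega>"
  shows "A z = P z" "B z = Q z"
proof -
  note h = has_stemD[OF assms(1)]
  have 1: "A z + K * B z = P z + K * Q z"
    using eq[OF z] h(1)[OF z K] by simp
  have 2: "A z - K * B z = P z - K * Q z"
    using eq[OF plane_cnj_stem_domain[OF z]] h(1)[OF plane_cnj_stem_domain[OF z] K] h(2,3)[OF z]
      P[OF z] Q[OF z] by simp
  have "(A z + K * B z) + (A z - K * B z) = (P z + K * Q z) + (P z - K * Q z)"
    by (simp only: 1 2)
  then have "A z + A z = P z + P z"
    by simp
  then show A: "A z = P z"
    by (simp add: quat_eq_iff)
  have "K * (K * B z) = K * (K * Q z)"
    using 1 A by simp
  then show "B z = Q z"
    by (simp add: imag_unit_square[OF K])
qed

lemma domain_slice_representation: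
  assumes "I \<in> imag_units" "q \<in> \<Omega>"
  obtains K z where "K \<in> imag_units" "z \<in> stem_domain \<Omega>" "q = slice_at K z"
    "z = (qre q, norm (qim q))"
proof -
  obtain K where K: "K \<in> imag_units" "q = slice_pt K (qre q) (norm (qim q))"
    using quat_slice_representation[OF assms(1)] by blast
  then show ?thesis
    using that[of K "(qre q, norm (qim q))"] assms(2) by (simp add: stem_domain_iff[OF K(1)])
qed

end

section \<open>The regular product\<close>

text \<open>
  Since \<open>J w = cnj w J\<close> for \<open>w\<close> in \<open>L_I\<close>, the defining formula of the product is
  \<open>F g(z) + G J g(cnj z)\<close>. Inserting \<open>g(z) = c + I d\<close> and \<open>g(cnj z) = c - I d\<close>, and moving \<open>I\<close> to the
  left past \<open>F\<close> and \<open>G J\<close> (with a change of sign for the latter), this becomes \<open>f(z) c + I f(z) d\<close>.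
\<close>

lemma product_formula_conv_stem:
  assumes IJ: "orthogonal_units I J"
    and sl: "F \<in> slice I" "G \<in> slice I" "H' \<in> slice I" "K' \<in> slice I"
    and f: "F + G * J = a + I * b" and g: "H + K * J = c + I * d" and g': "H' + K' * J = c - I * d"
  shows "(F * H - G * qcnj K') + (F * K + G * qcnj H') * J =
    (a * c - b * d) + I * (a * d + b * c)"
proof -
  have I: "I \<in> imag_units" and J: "J \<in> imag_units"
    using IJ by (simp_all add: orthogonal_units_def)
  have J': "J * (I * q) = - (I * (J * q))" for q
    using arg_cong[OF orthogonal_units_anticommute[OF IJ], of "\<lambda>p. p * q"] by (simp add: mult.assoc)
  have comm: "F * (I * q) = I * (F * q)" "G * (I * q) = I * (G * q)" for q
    using slice_commute[OF sl(1)] slice_commute[OF sl(2)] by (metis mult.assoc)+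
  have "qcnj K' = - (J * K' * J)"
    using slice_mult_orthogonal_unit[OF IJ sl(4)] by (simp add: mult.assoc imag_unit_square[OF J])
  moreover have "qcnj H' * J = J * H'"
    using slice_mult_orthogonal_unit[OF IJ sl(3)] by simp
  ultimately have "(F * H - G * qcnj K') + (F * K + G * qcnj H') * J =
      F * (H + K * J) + G * J * (H' + K' * J)"
    by (simp add: algebra_simps)
  also have "\<dots> = (F + G * J) * c + I * ((F + G * J) * d)"
    unfolding g g' by (simp add: algebra_simps J' comm)
  also have "\<dots> = (a * c - b * d) + I * (a * d + b * c)"
    unfolding f by (simp add: algebra_simps imag_unit_square[OF I])
  finally show ?thesis .
qed

context symmetric_slice_domain
begin

text \<open>
  For a regular function, a stem formula valid on a single slice is valid on all of them.
\<close>

lemma has_stem_of_slice: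
  assumes h: "regular_on \<Omega> h" and K: "K \<in> imag_units" and st: "is_stem (stem_domain \<Omega>) P Q"
    and eq: "\<And>z. z \<in> stem_domain \<Omega> \<Longrightarrow> h (slice_at K z) = P z + K * Q z"
  shows "has_stem \<Omega> h P Q"
proof -
  obtain A B where AB: "has_stem \<Omega> h A B"
    using regular_has_stem[OF K h] .
  have "A z = P z" "B z = Q z" if "z \<in> stem_domain \<Omega>" for z
    using has_stem_unique_on_slice[OF AB K _ _ eq that] st by (simp_all add: is_stem_def)
  then show ?thesis
    using AB st by (simp add: has_stem_def)
qed

lemma has_stem_agree:
  assumes "has_stem \<Omega> f A B" "has_stem \<Omega> g A B" "I \<in> imag_units" "q \<in> \<Omega>"
  shows "f q = g q"
  using domain_slice_representation[OF assms(3,4)] has_stemD(1)[OF assms(1)] has_stemD(1)[OF assms(2)]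
  by metis

lemma regular_product_on_slice:
  assumes IJ: "orthogonal_units I J" and f: "has_stem \<Omega> f A B" and g: "has_stem \<Omega> g C D"
    and fs: "splits_on (\<Omega> \<inter> slice I) I J f F G" and gs: "splits_on (\<Omega> \<inter> slice I) I J g H K"
    and z: "z \<in> stem_domain \<Omega>"
  shows "(F (slice_at I z) * H (slice_at I z) - G (slice_at I z) * qcnj (K (qcnj (slice_at I z)))) +
      (F (slice_at I z) * K (slice_at I z) + G (slice_at I z) * qcnj (H (qcnj (slice_at I z)))) * J =
    (A z * C z - B z * D z) + I * (A z * D z + B z * C z)"
proof (rule product_formula_conv_stem[OF IJ])
  have I: "I \<in> imag_units"
    using IJ by (simp add: orthogonal_units_def)
  have c: "qcnj (slice_at I z) = slice_at I (plane_cnj z)"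
    by (simp add: qcnj_slice_pt[OF I])
  have mem: "slice_at I z \<in> \<Omega> \<inter> slice I" "slice_at I (plane_cnj z) \<in> \<Omega> \<inter> slice I"
    using z plane_cnj_stem_domain[OF z] stem_domain_iff[OF I] by (simp_all del: plane_cnj_simps)
  note D = fs[unfolded splits_on_def, rule_format, OF mem(1)]
    gs[unfolded splits_on_def, rule_format, OF mem(1)]
    gs[unfolded splits_on_def, rule_format, OF mem(2)]
  show "F (slice_at I z) \<in> slice I" "G (slice_at I z) \<in> slice I"
    "H (qcnj (slice_at I z)) \<in> slice I" "K (qcnj (slice_at I z)) \<in> slice I"
    unfolding c using D by blast+
  show "F (slice_at I z) + G (slice_at I z) * J = A z + I * B z"
    using D(1) has_stemD(1)[OF f z I] by simp
  show "H (slice_at I z) + K (slice_at I z) * J = C z + I * D z"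
    using D(2) has_stemD(1)[OF g z I] by simp
  show "H (qcnj (slice_at I z)) + K (qcnj (slice_at I z)) * J = C z - I * D z"
    unfolding c using D(3) has_stemD(1)[OF g plane_cnj_stem_domain[OF z] I] has_stemD(2,3)[OF g z]
    by (simp del: plane_cnj_simps)
qed

lemma regular_split_holomorphic:
  assumes IJ: "orthogonal_units I J" and f: "regular_on \<Omega> f"
  shows "slice_holomorphic_on I (\<Omega> \<inter> slice I) (\<lambda>q. slice_proj I (f q))"
    and "slice_holomorphic_on I (\<Omega> \<inter> slice I) (\<lambda>q. - slice_proj I (f q * J))"
proof -
  have I: "I \<in> imag_units"
    using IJ by (simp add: orthogonal_units_def)
  have hol: "left_holomorphic_at I (\<lambda>z. f (slice_at I z)) z" if "z \<in> stem_domain \<Omega>" for z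
    using f I that by (simp add: regular_on_iff)
  have "bounded_linear (\<lambda>q. - slice_proj I (q * J))"
    by (intro bounded_linear_minus bounded_linear_compose[OF bounded_linear_slice_proj]
        bounded_linear_mult_left)
  then show "slice_holomorphic_on I (\<Omega> \<inter> slice I) (\<lambda>q. slice_proj I (f q))"
    "slice_holomorphic_on I (\<Omega> \<inter> slice I) (\<lambda>q. - slice_proj I (f q * J))"
    unfolding slice_holomorphic_on_iff[OF I]
    by (intro ballI left_holomorphic_at_linear[OF hol] bounded_linear_slice_proj;
        simp add: slice_proj_mult_left mult.assoc)+
qed

text \<open>
  The right-hand side does not refer to any slice or splitting, so the product is independent of both.
\<close>

lemma is_regular_product_iff_stem:
  assumes IJ: "orthogonal_units I J" and f: "has_stem \<Omega> f A B" and g: "has_stem \<Omega> g C D"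
  shows "is_regular_product \<Omega> f g h \<longleftrightarrow>
    has_stem \<Omega> h (\<lambda>z. A z * C z - B z * D z) (\<lambda>z. A z * D z + B z * C z)"
    (is "_ \<longleftrightarrow> has_stem \<Omega> h ?P ?Q")
proof
  have st: "is_stem (stem_domain \<Omega>) ?P ?Q"
    by (rule is_stem_mult) (use f g in \<open>simp_all add: has_stem_def\<close>)
  assume "is_regular_product \<Omega> f g h"
  then obtain I' J' F G H K where h: "regular_on \<Omega> h" "orthogonal_units I' J'"
    "splits_on (\<Omega> \<inter> slice I') I' J' f F G" "splits_on (\<Omega> \<inter> slice I') I' J' g H K"
    "\<And>z. z \<in> \<Omega> \<inter> slice I' \<Longrightarrow>
        h z = (F z * H z - G z * qcnj (K (qcnj z))) + (F z * K z + G z * qcnj (H (qcnj z))) * J'"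
    unfolding is_regular_product_def by blast
  have I': "I' \<in> imag_units"
    using h(2) by (simp add: orthogonal_units_def)
  have "h (slice_at I' z) = ?P z + I' * ?Q z" if z: "z \<in> stem_domain \<Omega>" for z
    using h(5)[of "slice_at I' z"] regular_product_on_slice[OF h(2) f g h(3,4) z] z stem_domain_iff[OF I']
    by simp
  then show "has_stem \<Omega> h ?P ?Q"
    by (rule has_stem_of_slice[OF h(1) I' st])
next
  assume h: "has_stem \<Omega> h ?P ?Q"
  have I: "I \<in> imag_units"
    using IJ by (simp add: orthogonal_units_def)
  let ?F = "\<lambda>q. slice_proj I (f q)" and ?G = "\<lambda>q. - slice_proj I (f q * J)"
  let ?H = "\<lambda>q. slice_proj I (g q)" and ?K = "\<lambda>q. - slice_proj I (g q * J)"
  have "h q = (?F q * ?H q - ?G q * qcnj (?K (qcnj q))) + (?F q * ?K q + ?G q * qcnj (?H (qcnj q))) * J"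
    if qmem: "q \<in> \<Omega> \<inter> slice I" for q
  proof -
    obtain x y where q: "q = slice_at I (x, y)"
      using qmem by (auto simp: slice_def)
    have z: "(x, y) \<in> stem_domain \<Omega>"
      using qmem q stem_domain_iff[OF I] by simp
    show ?thesis
      using regular_product_on_slice[OF IJ f g splits_on_slice_proj[OF IJ] splits_on_slice_proj[OF IJ] z]
        has_stemD(1)[OF h z I] unfolding q by (rule trans[OF _ sym, rotated])
  qed
  then show "is_regular_product \<Omega> f g h"
    unfolding is_regular_product_def
    using IJ has_stem_imp_regular[OF h] splits_on_slice_proj[OF IJ]
      regular_split_holomorphic[OF IJ has_stem_imp_regular[OF f]]
      regular_split_holomorphic[OF IJ has_stem_imp_regular[OF g]]
    by (intro conjI exI[of _ I] exI[of _ J] exI[of _ ?F] exI[of _ ?G] exI[of _ ?H] exI[of _ ?K] ballI)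
      blast+
qed

text \<open>
  Existence of a product comes from realizing the product stem, so the choice operator in the
  definition of the product does return one.
\<close>

lemma regular_product_has_stem:
  assumes IJ: "orthogonal_units I J" and f: "has_stem \<Omega> f A B" and g: "has_stem \<Omega> g C D"
  shows "has_stem \<Omega> (regular_product \<Omega> f g)
    (\<lambda>z. A z * C z - B z * D z) (\<lambda>z. A z * D z + B z * C z)"
proof -
  have I: "I \<in> imag_units"
    using IJ by (simp add: orthogonal_units_def)
  have "is_stem (stem_domain \<Omega>) (\<lambda>z. A z * C z - B z * D z) (\<lambda>z. A z * D z + B z * C z)"
    by (rule is_stem_mult) (use f g in \<open>simp_all add: has_stem_def\<close>)
  from is_stem_realized[OF I this] obtain h where "is_regular_product \<Omega> f g h"
    unfolding is_regular_product_iff_stem[OF assms] by metis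
  then show ?thesis
    unfolding regular_product_def is_regular_product_iff_stem[OF assms, symmetric]
    by (rule someI[where P = "is_regular_product \<Omega> f g"])
qed

section \<open>The operator \<open>R\<close>\<close>

lemma has_stem_minus_const:
  "has_stem \<Omega> (\<lambda>q. q - c) (\<lambda>z. of_real (fst z) - c) (\<lambda>z. of_real (snd z))"
  unfolding has_stem_def is_stem_def
proof (intro conjI ballI)
  fix z :: "real \<times> real"
  have "((\<lambda>z. of_real (fst z) - c) has_derivative (\<lambda>h. of_real (fst h))) (at z)"
    "((\<lambda>z. of_real (snd z) :: quat) has_derivative (\<lambda>h. of_real (snd h))) (at z)"
    by (auto intro!: derivative_eq_intros)
  then show "\<exists>A' B'. ((\<lambda>z. of_real (fst z) - c) has_derivative A') (at z) \<and>
      ((\<lambda>z. of_real (snd z)) has_derivative B') (at z) \<and>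
      A' (1, 0) = B' (0, 1) \<and> A' (0, 1) = - B' (1, 0)"
    by (intro exI conjI) (assumption+, simp_all)
qed (simp_all add: slice_pt_def)

lemma slice_difference_quotient_regular:
  assumes IJ: "orthogonal_units I J" and f: "regular_on \<Omega> f" and q0: "q0 \<in> \<Omega>" "q0 \<in> slice I"
  obtains r C D where "has_stem \<Omega> r C D"
    "\<And>z. z \<in> stem_domain \<Omega> \<Longrightarrow> f (slice_at I z) = f q0 + (slice_at I z - q0) * r (slice_at I z)"
proof -
  have I: "I \<in> imag_units"
    using IJ by (simp add: orthogonal_units_def)
  obtain x y where q0xy: "q0 = slice_at I (x, y)"
    using q0(2) by (auto simp: slice_def)
  have z0: "(x, y) \<in> stem_domain \<Omega>"
    using q0 q0xy stem_domain_iff[OF I] by simp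
  have hol: "left_holomorphic_at I (\<lambda>z. f (slice_at I z)) z" if "z \<in> stem_domain \<Omega>" for z
    using f I that by (simp add: regular_on_iff)
  obtain \<rho> where \<rho>: "\<And>z. z \<in> stem_domain \<Omega> \<Longrightarrow> left_holomorphic_at I \<rho> z"
    "\<And>z. z \<in> stem_domain \<Omega> \<Longrightarrow> f (slice_at I z) = f (slice_at I (x, y)) + (slice_at I z - slice_at I (x, y)) * \<rho> z"
    using slice_difference_quotient[OF IJ hol open_stem_domain[OF I] z0] by metis
  let ?C = "\<lambda>z. (1/2) *\<^sub>R (\<rho> z + \<rho> (plane_cnj z))" and ?D = "\<lambda>z. (1/2) *\<^sub>R (I * (\<rho> (plane_cnj z) - \<rho> z))"
  have "is_stem (stem_domain \<Omega>) ?C ?D"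
    by (rule is_stem_of_left_holomorphic[OF I \<rho>(1) plane_cnj_stem_domain])
  then obtain r where r: "has_stem \<Omega> r ?C ?D"
    using is_stem_realized[OF I] by metis
  have "r (slice_at I z) = \<rho> z" if "z \<in> stem_domain \<Omega>" for z
    using has_stemD(1)[OF r that I] even_odd_parts[OF I, of "\<rho> z" "\<rho> (plane_cnj z)"] by simp
  then show ?thesis
    using that[OF r] \<rho>(2) unfolding q0xy by simp
qed

text \<open>
  A witness is the extension of the difference quotient on the slice of \<open>I\<close> through \<open>q0\<close>. There the
  factor \<open>q - q0\<close> lies in \<open>L_I\<close> and commutes with \<open>I\<close>, so the regular product with it is the pointwise
  product; both sides of the equation are regular and agree on that slice, hence everywhere.
\<close>

lemma R_op_spec:
  assumes IJ: "orthogonal_units I J" and f: "regular_on \<Omega> f" and q0: "q0 \<in> \<Omega>" "q0 \<in> slice I"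
  shows "regular_on \<Omega> (R_op \<Omega> q0 f)"
    and "\<And>q. q \<in> \<Omega> \<Longrightarrow> f q = f q0 + regular_product \<Omega> (\<lambda>q. q - q0) (R_op \<Omega> q0 f) q"
proof -
  have I: "I \<in> imag_units"
    using IJ by (simp add: orthogonal_units_def)
  obtain r C D where r: "has_stem \<Omega> r C D"
    and rq: "\<And>z. z \<in> stem_domain \<Omega> \<Longrightarrow> f (slice_at I z) = f q0 + (slice_at I z - q0) * r (slice_at I z)"
    using slice_difference_quotient_regular[OF assms] by metis
  let ?p = "regular_product \<Omega> (\<lambda>q. q - q0) r"
  let ?P = "\<lambda>z. (of_real (fst z) - q0) * C z - of_real (snd z) * D z"
  let ?Q = "\<lambda>z. (of_real (fst z) - q0) * D z + of_real (snd z) * C z"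
  have p: "has_stem \<Omega> ?p ?P ?Q"
    by (rule regular_product_has_stem[OF IJ has_stem_minus_const r])
  have f': "regular_on \<Omega> (\<lambda>q. f q - f q0)"
    unfolding regular_on_iff
  proof (intro ballI)
    fix K z assume "K \<in> imag_units" "z \<in> stem_domain \<Omega>"
    then have "left_holomorphic_at K (\<lambda>z. f (slice_at K z)) z"
      using f by (simp add: regular_on_iff)
    moreover have "left_holomorphic_at K (\<lambda>z. f q0) z"
      unfolding left_holomorphic_at_def by (intro exI[of _ "\<lambda>h. 0"]) simp
    ultimately show "left_holomorphic_at K (\<lambda>z. f (slice_at K z) - f q0) z"
      by (rule left_holomorphic_at_diff)
  qed
  \<comment> \<open>Only on the slice through \<open>q0\<close> does the product stem reduce to \<open>(q - q0) r(q)\<close>.\<close>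
  have comm: "q0 * (I * q) = I * (q0 * q)" for q
    using slice_commute[OF q0(2)] by (metis mult.assoc)
  have eq: "f (slice_at I z) - f q0 = ?P z + I * ?Q z" if z: "z \<in> stem_domain \<Omega>" for z
    using rq[OF z] has_stemD(1)[OF r z I] 
    by (simp add: slice_pt_eq of_real_def algebra_simps imag_unit_square[OF I] comm)
  have "is_stem (stem_domain \<Omega>) ?P ?Q"
    using p unfolding has_stem_def by blast
  then have fP: "has_stem \<Omega> (\<lambda>q. f q - f q0) ?P ?Q"
    by (rule has_stem_of_slice[OF f' I _ eq])
  have "f q = f q0 + ?p q" if "q \<in> \<Omega>" for q
    using has_stem_agree[OF p fP I that] by simp
  then have "\<exists>r. regular_on \<Omega> r \<and> (\<forall>q\<in>\<Omega>. f q = f q0 + regular_product \<Omega> (\<lambda>q. q - q0) r q)"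
    using has_stem_imp_regular[OF r] by blast
  from someI_ex[OF this] show "regular_on \<Omega> (R_op \<Omega> q0 f)"
    "\<And>q. q \<in> \<Omega> \<Longrightarrow> f q = f q0 + regular_product \<Omega> (\<lambda>q. q - q0) (R_op \<Omega> q0 f) q"
    unfolding R_op_def by blast+
qed

end

section \<open>The real derivative of a regular function\<close>

text \<open>
  The product rule when the first factor vanishes at the point: the second factor need only be
  continuous.
\<close>

lemma has_derivative_linear_times_continuous:
  fixes L g :: "'a::real_normed_vector \<Rightarrow> 'b::real_normed_algebra"
  assumes L: "bounded_linear L" and g: "isCont g q0"
  shows "((\<lambda>q. L (q - q0) * g q) has_derivative (\<lambda>v. L v * g q0)) (at q0)"
proof (rule has_derivativeI)
  interpret L: bounded_linear L by (rule L)
  obtain c where c: "\<And>v. norm (L v) \<le> norm v * c" "c > 0"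
    using L.pos_bounded by blast
  show "bounded_linear (\<lambda>v. L v * g q0)"
    by (rule bounded_linear_compose[OF bounded_linear_mult_left L])
  have "((\<lambda>q. c * norm (g q - g q0)) \<longlongrightarrow> c * norm (g q0 - g q0)) (at q0)"
    using g unfolding isCont_def by (intro tendsto_intros)
  then have lim: "((\<lambda>q. c * norm (g q - g q0)) \<longlongrightarrow> 0) (at q0)"
    by simp
  show "((\<lambda>q. ((L (q - q0) * g q - L (q0 - q0) * g q0) - L (q - q0) * g q0) /\<^sub>R norm (q - q0))
      \<longlongrightarrow> 0) (at q0)"
  proof (rule Lim_null_comparison[OF _ lim])
    have "norm ((L (q - q0) * g q - L (q0 - q0) * g q0 - L (q - q0) * g q0) /\<^sub>R norm (q - q0))
        \<le> c * norm (g q - g q0)" if "q \<noteq> q0" for q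
    proof -
      let ?X = "L (q - q0) * g q - L (q0 - q0) * g q0 - L (q - q0) * g q0"
      have "norm ?X \<le> norm (L (q - q0)) * norm (g q - g q0)"
        using norm_mult_ineq[of "L (q - q0)" "g q - g q0"] by (simp add: L.zero right_diff_distrib)
      also have "\<dots> \<le> norm (q - q0) * c * norm (g q - g q0)"
        by (intro mult_right_mono c) simp
      finally have "norm ?X / norm (q - q0) \<le> c * norm (g q - g q0)"
        using that by (simp add: pos_divide_le_eq mult.commute mult.left_commute)
      then show ?thesis
        by (simp only: norm_scaleR norm_inverse abs_norm_cancel real_norm_def
            divide_inverse mult.commute[of "norm ?X"] abs_inverse)
    qed
    then show "\<forall>\<^sub>F q in at q0. norm ((L (q - q0) * g q - L (q0 - q0) * g q0 - L (q - q0) * g q0) /\<^sub>R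
        norm (q - q0)) \<le> c * norm (g q - g q0)"
      by (simp add: eventually_at_filter)
  qed
qed

text \<open>
  For a regular \<open>r\<close> with stem \<open>(C, D)\<close> the value at \<open>x + y K\<close> is \<open>D (x, y) / y\<close> when \<open>y \<noteq> 0\<close>, whatever
  the unit \<open>K\<close>. At real points it is \<open>0\<close>, because \<open>inverse 0 = 0\<close>.
\<close>

definition spherical_derivative :: "(quat \<Rightarrow> quat) \<Rightarrow> quat \<Rightarrow> quat" where
  "spherical_derivative r q = inverse (2 *\<^sub>R qim q) * (r q - r (qcnj q))"

context symmetric_slice_domain
begin

lemma has_stem_value:
  assumes f: "has_stem \<Omega> f A B" and I: "I \<in> imag_units" and q: "q \<in> \<Omega>"
  shows "f q = A (qre q, norm (qim q)) + sgn (qim q) * B (qre q, norm (qim q))"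
proof -
  obtain K z where K: "K \<in> imag_units" and z: "z \<in> stem_domain \<Omega>" "q = slice_at K z"
    "z = (qre q, norm (qim q))"
    using domain_slice_representation[OF I q] .
  have "sgn (qim q) * B z = K * B z"
  proof (cases "qim q = 0")
    case True
    then have "plane_cnj z = z"
      using z(3) by (simp add: plane_cnj_def)
    then have "B z = 0"
      using has_stemD(3)[OF f z(1)] by (simp add: quat_eq_iff)
    then show ?thesis
      by simp
  next
    case False
    have "qim q = norm (qim q) *\<^sub>R K"
      using z(2,3) qim_slice_pt[OF K] by (metis snd_conv)
    then have "sgn (qim q) = K"
      using False norm_imag_unit[OF K]
      by (metis sgn_scaleR sgn_div_norm div_by_1 inverse_1 scaleR_one sgn_pos zero_less_norm_iff)
    then show ?thesis
      by simp
  qed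
  moreover have "f q = A z + K * B z"
    using has_stemD(1)[OF f z(1) K] z(2) by simp
  ultimately show ?thesis
    unfolding z(3)[symmetric] by (simp only:)
qed

text \<open>
  Regularity asks for differentiability on slices only. Continuity in all four real variables follows
  from the stem, the only delicate points being the real ones, where the unit of \<open>q\<close> jumps but its
  coefficient \<open>B\<close> tends to zero.
\<close>

lemma regular_isCont:
  assumes I: "I \<in> imag_units" and f: "regular_on \<Omega> f" and p: "p \<in> \<Omega>"
  shows "isCont f p"
proof -
  obtain A B where AB: "has_stem \<Omega> f A B"
    using regular_has_stem[OF I f] .
  define \<zeta> where "\<zeta> q = (qre q, norm (qim q))" for q
  have val: "f q = A (\<zeta> q) + sgn (qim q) * B (\<zeta> q)" if "q \<in> \<Omega>" for q
    using has_stem_value[OF AB I that] by (simp add: \<zeta>_def)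
  have \<zeta>p: "\<zeta> p \<in> stem_domain \<Omega>"
    using domain_slice_representation[OF I p] by (metis \<zeta>_def)
  have im: "isCont qim p" "isCont qre p"
    by (simp_all add: linear_continuous_at bounded_linear_qim bounded_linear_qre)
  then have \<zeta>: "isCont \<zeta> p"
    unfolding \<zeta>_def by (intro continuous_intros)
  have "isCont A (\<zeta> p)" "isCont B (\<zeta> p)"
    using AB \<zeta>p has_derivative_continuous unfolding has_stem_def is_stem_def by blast+
  then have A: "isCont (\<lambda>q. A (\<zeta> q)) p" and B: "isCont (\<lambda>q. B (\<zeta> q)) p"
    using isCont_o2[OF \<zeta>] by blast+
  have "isCont (\<lambda>q. sgn (qim q) * B (\<zeta> q)) p"
  proof (cases "qim p = 0")
    case True
    then have "plane_cnj (\<zeta> p) = \<zeta> p"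
      by (simp add: \<zeta>_def plane_cnj_def)
    then have "B (\<zeta> p) = 0"
      using has_stemD(3)[OF AB \<zeta>p] by (simp add: quat_eq_iff)
    then have "((\<lambda>q. norm (B (\<zeta> q))) \<longlongrightarrow> 0) (at p)"
      using B by (simp add: isCont_def tendsto_norm_zero)
    moreover have "norm (sgn (qim q) * B (\<zeta> q)) \<le> norm (B (\<zeta> q))" for q
      by (simp add: norm_mult norm_sgn)
    then have "\<forall>\<^sub>F q in at p. norm (sgn (qim q) * B (\<zeta> q)) \<le> norm (B (\<zeta> q))"
      by simp
    ultimately have "((\<lambda>q. sgn (qim q) * B (\<zeta> q)) \<longlongrightarrow> 0) (at p)"
      by (rule Lim_null_comparison[rotated])
    then show ?thesis
      using \<open>B (\<zeta> p) = 0\<close> by (simp add: isCont_def)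
  next
    case False
    then show ?thesis
      by (intro continuous_mult B continuous_at_within_sgn im)
  qed
  then have cont: "isCont (\<lambda>q. A (\<zeta> q) + sgn (qim q) * B (\<zeta> q)) p"
    by (intro continuous_add A)
  have "\<forall>\<^sub>F q in nhds p. f q = A (\<zeta> q) + sgn (qim q) * B (\<zeta> q)"
    using val eventually_nhds_in_open[OF open_domain p] by (auto elim: eventually_mono)
  then show ?thesis
    using isCont_cong[THEN iffD2] cont by metis
qed

lemma has_stem_spherical_derivative:
  assumes r: "has_stem \<Omega> r C D" and K: "K \<in> imag_units" and z: "z \<in> stem_domain \<Omega>"
    and y: "snd z \<noteq> 0"
  shows "snd z *\<^sub>R spherical_derivative r (slice_at K z) = D z"
proof -
  have "r (slice_at K z) - r (qcnj (slice_at K z)) = 2 *\<^sub>R (K * D z)"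
    using has_stemD(1)[OF r z K] has_stemD(1)[OF r plane_cnj_stem_domain[OF z] K] has_stemD(2,3)[OF r z]
    by (simp add: qcnj_slice_pt[OF K] scaleR_2)
  moreover have "inverse (2 *\<^sub>R qim (slice_at K z)) = - ((1 / (2 * snd z)) *\<^sub>R K)"
    by (rule inverse_unique)
      (use y in \<open>simp add: qim_slice_pt[OF K] imag_unit_square[OF K]\<close>)
  ultimately show ?thesis
    using y by (simp add: spherical_derivative_def imag_unit_square[OF K])
qed

text \<open>
  In terms of stems, with \<open>q = x + y K\<close>, the regular product \<open>(q - q0) * r\<close> differs from the pointwise
  product by \<open>(q0 K - K q0) D\<close>. Since \<open>y K\<close> and \<open>q\<close> have the same commutator with \<open>q0\<close>, this is that of
  \<open>q0\<close> and \<open>q - q0\<close> times \<open>D / y\<close>, the spherical derivative of \<open>r\<close>.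
\<close>

lemma R_op_expansion:
  fixes f :: "quat \<Rightarrow> quat" and q0 :: quat
  defines "r \<equiv> R_op \<Omega> q0 f"
  assumes IJ: "orthogonal_units I J" and f: "regular_on \<Omega> f" and q0: "q0 \<in> \<Omega>" "q0 \<in> slice I"
    and q: "q \<in> \<Omega>"
  shows "f q = f q0 + (q - q0) * r q + (q0 * (q - q0) - (q - q0) * q0) * spherical_derivative r q"
proof -
  have I: "I \<in> imag_units"
    using IJ by (simp add: orthogonal_units_def)
  have r: "regular_on \<Omega> r"
    unfolding r_def by (rule R_op_spec(1)[OF IJ f q0])
  obtain C D where CD: "has_stem \<Omega> r C D"
    using regular_has_stem[OF I r] .
  obtain K z where K: "K \<in> imag_units" and z: "z \<in> stem_domain \<Omega>" "q = slice_at K z"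
    using domain_slice_representation[OF I q] by metis
  let ?x = "of_real (fst z) :: quat" and ?y = "snd z"
  have "f q - f q0 = regular_product \<Omega> (\<lambda>q. q - q0) r q"
    using R_op_spec(2)[OF IJ f q0 q] by (simp add: r_def)
  also have "\<dots> = ((?x - q0) * C z - of_real ?y * D z) + K * ((?x - q0) * D z + of_real ?y * C z)"
    unfolding z(2)
    by (rule has_stemD(1)[OF regular_product_has_stem[OF IJ has_stem_minus_const CD] z(1) K])
  also have "\<dots> = (q - q0) * (C z + K * D z) + (q0 * K - K * q0) * D z"
    by (simp add: z(2) slice_pt_eq of_real_def algebra_simps imag_unit_square[OF K])
  also have "C z + K * D z = r q"
    using has_stemD(1)[OF CD z(1) K] z(2) by simp
  also have "(q0 * K - K * q0) * D z = (q0 * (q - q0) - (q - q0) * q0) * spherical_derivative r q"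
  proof (cases "?y = 0")
    case True
    then have "plane_cnj z = z"
      by (simp add: plane_cnj_def prod_eq_iff)
    then have "D z = 0"
      using has_stemD(3)[OF CD z(1)] by (simp add: quat_eq_iff)
    moreover have "q0 * (q - q0) - (q - q0) * q0 = 0"
      using True by (simp add: z(2) slice_pt_eq algebra_simps)
    ultimately show ?thesis
      by simp
  next
    case False
    have "q0 * (q - q0) - (q - q0) * q0 = ?y *\<^sub>R (q0 * K - K * q0)"
      by (simp add: z(2) slice_pt_eq algebra_simps)
    then show ?thesis
      using has_stem_spherical_derivative[OF CD K z(1) False] z(2) by (metis mult_scaleR_left mult_scaleR_right)
  qed
  finally show ?thesis
    by (simp add: algebra_simps)
qed

lemma regular_has_derivative:
  fixes f :: "quat \<Rightarrow> quat" and q0 :: quat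
  defines "r \<equiv> R_op \<Omega> q0 f"
  assumes IJ: "orthogonal_units I J" and f: "regular_on \<Omega> f" and q0: "q0 \<in> \<Omega>" "q0 \<in> slice I"
  shows "(f has_derivative
    (\<lambda>v. v * r q0 + (q0 * v - v * q0) * spherical_derivative r q0)) (at q0)"
proof -
  have I: "I \<in> imag_units"
    using IJ by (simp add: orthogonal_units_def)
  have r: "regular_on \<Omega> r"
    unfolding r_def by (rule R_op_spec(1)[OF IJ f q0])
  let ?G = "spherical_derivative r" and ?c = "\<lambda>v. q0 * v - v * q0"
  have blc: "bounded_linear ?c"
    by (intro bounded_linear_sub bounded_linear_mult_left bounded_linear_mult_right)
  have 1: "((\<lambda>q. (q - q0) * r q) has_derivative (\<lambda>v. v * r q0)) (at q0)"
    by (rule has_derivative_linear_times_continuous[OF bounded_linear_ident regular_isCont[OF I r q0(1)]])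
  have 2: "((\<lambda>q. ?c (q - q0) * ?G q) has_derivative (\<lambda>v. ?c v * ?G q0)) (at q0)"
  proof (cases "qim q0 = 0")
    case True
    then have "q0 * v = v * q0" for v
      by (simp add: quat_eq_iff)
    then show ?thesis
      by simp
  next
    case False
    have "isCont (\<lambda>q. r (qcnj q)) q0"
      using isCont_o2[OF linear_continuous_at[OF bounded_linear_qcnj]
          regular_isCont[OF I r qcnj_in_domain[OF I q0(1)]]] .
    moreover have "isCont (\<lambda>q. inverse (2 *\<^sub>R qim q)) q0"
      using False
      by (intro continuous_at_within_inverse continuous_scaleR continuous_const
          linear_continuous_at bounded_linear_qim) simp
    ultimately have "isCont ?G q0"
      unfolding spherical_derivative_def
      by (intro continuous_mult continuous_diff regular_isCont[OF I r q0(1)])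
    then show ?thesis
      by (rule has_derivative_linear_times_continuous[OF blc])
  qed
  have "((\<lambda>q. f q0 + ((q - q0) * r q + ?c (q - q0) * ?G q)) has_derivative
      (\<lambda>v. 0 + (v * r q0 + ?c v * ?G q0))) (at q0)"
    by (intro has_derivative_add has_derivative_const 1 2)
  then have "((\<lambda>q. f q0 + ((q - q0) * r q + ?c (q - q0) * ?G q)) has_derivative
      (\<lambda>v. v * r q0 + ?c v * ?G q0)) (at q0)"
    by simp
  then show ?thesis
    by (rule has_derivative_transform_within_open[OF _ open_domain q0(1)])
      (use R_op_expansion[OF IJ f q0] in \<open>simp add: r_def add.assoc\<close>)
qed

end

text \<open>
  Here \<open>q0 L - L q0 = - L (2 Im q0)\<close>, which cancels the denominator of the spherical derivative and
  replaces \<open>r(q0)\<close> by \<open>r(cnj q0)\<close>; for real \<open>q0\<close> the two points coincide.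
\<close>

lemma derivative_orthogonal_direction:
  assumes I: "I \<in> imag_units" and q0: "q0 \<in> slice I" and L: "L * I = - (I * L)"
  shows "L * r q0 + (q0 * L - L * q0) * spherical_derivative r q0 = L * r (qcnj q0)"
proof -
  obtain x y where q0xy: "q0 = slice_pt I x y"
    using q0 by (auto simp: slice_def)
  have c: "q0 * L - L * q0 = - (L * (2 *\<^sub>R qim q0))"
    unfolding q0xy qim_slice_pt[OF I] by (simp add: slice_pt_eq algebra_simps L flip: scaleR_2)
  show ?thesis
  proof (cases "qim q0 = 0")
    case True
    then have "qcnj q0 = q0"
      by (simp add: quat_eq_iff)
    then show ?thesis
      using True by (simp add: c)
  next
    case False
    then have "2 *\<^sub>R qim q0 * inverse (2 *\<^sub>R qim q0) = 1"
      by (intro right_inverse) simp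
    then have "(q0 * L - L * q0) * spherical_derivative r q0 = - (L * (r q0 - r (qcnj q0)))"
      unfolding c spherical_derivative_def by (metis minus_mult_left mult.assoc mult_1)
    then show ?thesis
      by (simp add: algebra_simps)
  qed
qed

section \<open>The complex Jacobian matrices\<close>

lemma partials_of_split:
  assumes P: "bounded_linear P" and f: "(f has_derivative T) (at q)"
    and S: "open S" "q \<in> S" and g: "\<And>p. p \<in> S \<Longrightarrow> g p = P (f p)"
  shows "has_partials I J g q" "partial e g q = P (T e)"
proof -
  have "((\<lambda>p. P (f p)) has_derivative (\<lambda>v. P (T v))) (at q)"
    by (rule bounded_linear.has_derivative[OF P f])
  then have dg: "(g has_derivative (\<lambda>v. P (T v))) (at q)"
    by (rule has_derivative_transform_within_open[OF _ S]) (simp add: g)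
  have "linear (\<lambda>v. P (T v))"
    by (rule has_derivative_linear[OF dg])
  then have lin: "P (T (t *\<^sub>R e)) = t *\<^sub>R P (T e)" for t e
    by (rule linear_scale)
  have d: "((\<lambda>t. g (q + t *\<^sub>R e)) has_vector_derivative P (T e)) (at 0)" for e
  proof -
    have "((\<lambda>t::real. q + t *\<^sub>R e) has_derivative (\<lambda>t. t *\<^sub>R e)) (at 0)"
      by (auto intro!: derivative_eq_intros)
    from has_derivative_compose[OF this, of g "\<lambda>v. P (T v)"] dg show ?thesis
      by (simp add: has_vector_derivative_def lin)
  qed
  show "partial e g q = P (T e)"
    unfolding partial_def by (rule vector_derivative_at[OF d])
  show "has_partials I J g q"
    unfolding has_partials_def using d differentiableI_vector by blast
qed

theorem theorem6p3:
  fixes \<Omega> :: "quat set" and f f1 f2 :: "quat \<Rightarrow> quat" and q0 I J :: quat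
  assumes "slice_domain \<Omega>" and "symmetric_set \<Omega>"
    and "regular_on \<Omega> f" and "q0 \<in> \<Omega>"
    and "orthogonal_units I J" and "q0 \<in> slice I"
    and "splits_on \<Omega> I J f f1 f2"
  shows "has_partials I J f1 q0 \<and> has_partials I J f2 q0 \<and>
    matrix2 (dbar1 I f1 q0) (dbar2 I J f1 q0)
            (dbar1 I f2 q0) (dbar2 I J f2 q0) = matrix2 0 0 0 0 \<and>
    (\<forall>R1 R2. splits_on \<Omega> I J (R_op \<Omega> q0 f) R1 R2 \<longrightarrow>
      matrix2 (d1 I f1 q0) (d2 I J f1 q0)
              (d1 I f2 q0) (d2 I J f2 q0) =
      matrix2 (R1 q0) (- qcnj (R2 (qcnj q0)))
              (R2 q0) (qcnj (R1 (qcnj q0))))"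
proof -
  interpret symmetric_slice_domain \<Omega>
    using assms(1,2) by unfold_locales
  note IJ = assms(5) and q0 = assms(4,6)
  have I: "I \<in> imag_units" and J: "J \<in> imag_units"
    using IJ by (simp_all add: orthogonal_units_def)
  define r where "r = R_op \<Omega> q0 f"
  define T where "T v = v * r q0 + (q0 * v - v * q0) * spherical_derivative r q0" for v
  define s where "s = r (qcnj q0)"
  have dT: "(f has_derivative T) (at q0)"
    unfolding T_def r_def by (rule regular_has_derivative[OF IJ assms(3) q0])
  \<comment> \<open>The two vectors of each pair \<open>1, I\<close> and \<open>J, I J\<close> have values that differ by the left factor \<open>I\<close>.\<close>
  have T: "T 1 = r q0" "T I = I * r q0" "T J = J * s" "T (I * J) = I * (J * s)"
  proof -
    show "T 1 = r q0" "T I = I * r q0"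
      using slice_commute[OF q0(2)] by (simp_all add: T_def)
    have "J * I = - (I * J)"
      by (rule orthogonal_units_anticommute[OF IJ])
    moreover from this have "I * J * I = - (I * (I * J))"
      by (simp add: mult.assoc)
    ultimately show "T J = J * s" "T (I * J) = I * (J * s)"
      unfolding T_def s_def
      using derivative_orthogonal_direction[OF I q0(2), of J r]
        derivative_orthogonal_direction[OF I q0(2), of "I * J" r] by (simp_all add: mult.assoc)
  qed
  define P1 where "P1 = slice_proj I"
  define P2 where "P2 q = - slice_proj I (q * J)" for q
  have bl: "bounded_linear P1" "bounded_linear P2"
    unfolding P1_def P2_def
    by (intro bounded_linear_minus bounded_linear_compose[OF bounded_linear_slice_proj]
        bounded_linear_mult_left bounded_linear_slice_proj)+
  have lin: "P1 (I * q) = I * P1 q" "P2 (I * q) = I * P2 q" for q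
    by (simp_all add: P1_def P2_def slice_proj_mult_left mult.assoc)
  have split: "f1 p = P1 (f p)" "f2 p = P2 (f p)" if "p \<in> \<Omega>" for p
    unfolding P1_def P2_def using splits_onD[OF assms(7) IJ that] by simp_all
  note part1 = partials_of_split[OF bl(1) dT open_domain q0(1) split(1)]
  note part2 = partials_of_split[OF bl(2) dT open_domain q0(1) split(2)]
  have dbar: "dbar1 I f1 q0 = 0" "dbar2 I J f1 q0 = 0" "dbar1 I f2 q0 = 0" "dbar2 I J f2 q0 = 0"
    by (simp_all add: dbar1_def dbar2_def part1(2) part2(2) T lin imag_unit_square[OF I])
  have d: "d1 I f1 q0 = P1 (r q0)" "d2 I J f1 q0 = P1 (J * s)"
    "d1 I f2 q0 = P2 (r q0)" "d2 I J f2 q0 = P2 (J * s)"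
    by (simp_all add: d1_def d2_def part1(2) part2(2) T lin imag_unit_square[OF I] scaleR_half_double)
  have "P1 (r q0) = R1 q0" "P2 (r q0) = R2 q0"
      "P1 (J * s) = - qcnj (R2 (qcnj q0))" "P2 (J * s) = qcnj (R1 (qcnj q0))"
    if R: "splits_on \<Omega> I J r R1 R2" for R1 R2
  proof -
    show "P1 (r q0) = R1 q0" "P2 (r q0) = R2 q0"
      unfolding P1_def P2_def using splits_onD[OF R IJ q0(1)] by simp_all
    have R': "R1 (qcnj q0) \<in> slice I" "R2 (qcnj q0) \<in> slice I"
      "s = R1 (qcnj q0) + R2 (qcnj q0) * J"
      using R qcnj_in_domain[OF I q0(1)] by (auto simp: splits_on_def s_def)
    have "J * s = J * R1 (qcnj q0) + J * R2 (qcnj q0) * J"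
      by (simp add: R'(3) distrib_left mult.assoc)
    also have "\<dots> = - qcnj (R2 (qcnj q0)) + qcnj (R1 (qcnj q0)) * J"
      by (simp add: slice_mult_orthogonal_unit[OF IJ] R' mult.assoc imag_unit_square[OF J])
    finally have "J * s = - qcnj (R2 (qcnj q0)) + qcnj (R1 (qcnj q0)) * J" .
    moreover have "- qcnj (R2 (qcnj q0)) \<in> slice I" "qcnj (R1 (qcnj q0)) \<in> slice I"
      using R'(1,2) uminus_in_slice qcnj_in_slice[OF I] by blast+
    ultimately show "P1 (J * s) = - qcnj (R2 (qcnj q0))" "P2 (J * s) = qcnj (R1 (qcnj q0))"
      unfolding P1_def P2_def by (simp_all only: slice_split_unique[OF IJ])
  qed
  then show ?thesis
    using part1(1) part2(1) by (simp add: dbar d flip: r_def)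
qed

end
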